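(* Let $\Omega\subset\mathbb{R}^N$ ($N\ge 2$) be a bounded smooth domain, $0<s<1<p<\infty$, $0<\alpha<1$, and let $\omega\in L^r(\Omega)\setminus\{0\}$ with $\omega\ge 0$ and $r\ge r_\alpha$. Let $$\lambda_\alpha:=\min\Big\{[v]_{s,p}^p:\ v\in W_0^{s,p}(\Omega),\ \int_\Omega|v|^{1-\alpha}\omega\,dx=1\Big\}=[u_\alpha]_{s,p}^{\,p\left(\frac{1-\alpha-p}{1-\alpha}\right)},$$ where $u_\alpha\in W_0^{s,p}(\Omega)$ is the unique weak solution of $(-\Delta_p)^s u=\omega u^{-\alpha}$ in $\Omega$, $u>0$ in $\Omega$, $u=0$ on $\mathbb{R}^N\setminus\Omega$. Then, for a real constant $C$, the inequality $$C\left(\int_\Omega|v|^{1-\alpha}\omega\,dx\right)^{\frac{p}{1-\alpha}}\le[v]_{s,p}^p\quad\text{for all }v\in W_0^{s,p}(\Omega)$$ holds if, and only if, $C\le\lambda_\alpha$.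
   Context: Gagliardo semi-norm: $[u]_{s,p}:=\left(\iint_{\mathbb{R}^{2N}}\frac{|u(x)-u(y)|^p}{|x-y|^{N+sp}}\,dx\,dy\right)^{1/p}$. $W_0^{s,p}(\Omega)$ is the completion of $C_c^\infty(\Omega)$ with respect to $([u]_{s,p}^p+\|u\|_p^p)^{1/p}$; equivalently $W_0^{s,p}(\Omega)=\{u\in L^p(\mathbb{R}^N):[u]_{s,p}<\infty,\ u=0 \text{ in }\mathbb{R}^N\setminus\Omega\}$, normed by $[\cdot]_{s,p}$. Pairing: $\langle(-\Delta_p)^s u,v\rangle:=\iint_{\mathbb{R}^{2N}}\frac{|u(x)-u(y)|^{p-2}(u(x)-u(y))(v(x)-v(y))}{|x-y|^{N+sp}}\,dx\,dy$ for $u,v\in W_0^{s,p}(\Omega)$. Weak solution: $u\in W_0^{s,p}(\Omega)$ is a weak solution of the singular problem $(-\Delta_p)^s u=\omega u^{-\alpha}$ in $\Omega$, $u>0$ in $\Omega$, $u=0$ on $\mathbb{R}^N\setminus\Omega$, if (i) for each subdomain $\Omega'$ compactly contained in $\Omega$ there is a constant $C_{\Omega'}>0$ with $u\ge C_{\Omega'}$ a.e. in $\Omega'$; and (ii) $\langle(-\Delta_p)^s u,\varphi\rangle=\int_\Omega\frac{\omega\varphi}{u^\alpha}\,dx$ for all $\varphi\in C_c^\infty(\Omega)$. Exponents: $p_s^\star:=\frac{Np}{N-sp}$ if $N>sp$ and $p_s^\star:=\infty$ if $N\le sp$; $t':=t/(t-1)$ is the Hölder conjugate. For $0<\alpha<1$: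 $r_\alpha:=\left(\frac{p_s^\star}{1-\alpha}\right)'$ if $sp<N$, and $r_\alpha:=\alpha^{-1}$ if $sp\ge N$. Under the stated assumptions on $\omega$ and $r$, the weak solution $u_\alpha$ exists and is unique, and the minimum defining $\lambda_\alpha$ is attained and equals the stated power of $[u_\alpha]_{s,p}$. *)

theory Defs
  imports "HOL-Analysis.Analysis"
begin

text \<open>All functions are real-valued functions on a Euclidean space \<open>'a\<close> of dimension
  \<open>N = DIM('a)\<close>. Elements of Lebesgue and Sobolev spaces are represented by Borel functions
  that are not identified almost everywhere; every notion below is invariant under changes on
  null sets.\<close>

section \<open>Smooth functions and smooth domains\<close>

text \<open>Meant for open \<open>S\<close>: all directional derivatives up to order \<open>k\<close> exist and are continuous.\<close>

primrec Ck_on :: "nat \<Rightarrow> ('a::euclidean_space \<Rightarrow> real) \<Rightarrow> 'a set \<Rightarrow> bool" where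
  "Ck_on 0 f S \<longleftrightarrow> continuous_on S f"
| "Ck_on (Suc k) f S \<longleftrightarrow>
     (\<forall>x\<in>S. f differentiable (at x)) \<and>
     (\<forall>h. Ck_on k (\<lambda>x. frechet_derivative f (at x) h) S)"

definition Cinf_on :: "('a::euclidean_space \<Rightarrow> real) \<Rightarrow> 'a set \<Rightarrow> bool" where
  "Cinf_on f S \<longleftrightarrow> (\<forall>k. Ck_on k f S)"

definition Cc_inf :: "'a::euclidean_space set \<Rightarrow> ('a \<Rightarrow> real) set" where
  "Cc_inf \<Omega> = {\<phi>. Cinf_on \<phi> UNIV \<and> compact (closure {x. \<phi> x \<noteq> 0}) \<and> closure {x. \<phi> x \<noteq> 0} \<subseteq> \<Omega>}"

text \<open>Near each boundary point, after a rotation taking \<open>\<nu>\<close> to the last coordinate direction,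
  \<open>\<Omega>\<close> is the region strictly above the graph of a smooth function \<open>\<gamma>\<close>. Only the values of
  \<open>\<gamma>\<close> on the hyperplane orthogonal to \<open>\<nu>\<close> are used.\<close>

definition smooth_boundary :: "'a::euclidean_space set \<Rightarrow> bool" where
  "smooth_boundary \<Omega> \<longleftrightarrow>
     (\<forall>x0 \<in> frontier \<Omega>. \<exists>r \<nu> \<gamma>. r > 0 \<and> norm \<nu> = 1 \<and> Cinf_on \<gamma> UNIV \<and>
        \<Omega> \<inter> ball x0 r = {x \<in> ball x0 r. \<gamma> (x - (x \<bullet> \<nu>) *\<^sub>R \<nu>) < x \<bullet> \<nu>})"

definition bounded_smooth_domain :: "'a::euclidean_space set \<Rightarrow> bool" where
  "bounded_smooth_domain \<Omega> \<longleftrightarrow>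
     open \<Omega> \<and> connected \<Omega> \<and> \<Omega> \<noteq> {} \<and> bounded \<Omega> \<and> smooth_boundary \<Omega>"

section \<open>Lebesgue and fractional Sobolev spaces\<close>

definition in_Lp :: "ereal \<Rightarrow> 'b measure \<Rightarrow> ('b \<Rightarrow> real) \<Rightarrow> bool" where
  "in_Lp r M f \<longleftrightarrow> f \<in> borel_measurable M \<and>
     (if r = \<infinity> then \<exists>K. AE x in M. \<bar>f x\<bar> \<le> K
      else (\<integral>\<^sup>+x. ennreal (\<bar>f x\<bar> powr real_of_ereal r) \<partial>M) < \<infinity>)"

text \<open>The \<open>p\<close>-th power of the Gagliardo semi-norm, possibly infinite. The diagonal, where the
  integrand is \<open>0\<close> by the convention \<open>0 / 0 = 0\<close>, is a null set.\<close>

definition gagliardo_energy :: "real \<Rightarrow> real \<Rightarrow> ('a::euclidean_space \<Rightarrow> real) \<Rightarrow> ennreal" where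
  "gagliardo_energy s p u =
     (\<integral>\<^sup>+(x, y). ennreal (\<bar>u x - u y\<bar> powr p / norm (x - y) powr (real DIM('a) + s * p))
        \<partial>(lborel \<Otimes>\<^sub>M lborel))"

text \<open>The semi-norm as a real number; only meaningful if the energy is finite.\<close>

definition gagliardo :: "real \<Rightarrow> real \<Rightarrow> ('a::euclidean_space \<Rightarrow> real) \<Rightarrow> real" where
  "gagliardo s p u = enn2real (gagliardo_energy s p u) powr (1 / p)"

definition Wsp :: "real \<Rightarrow> real \<Rightarrow> ('a::euclidean_space \<Rightarrow> real) set" where
  "Wsp s p = {u. in_Lp (ereal p) lborel u \<and> gagliardo_energy s p u < \<infinity>}"

text \<open>The \<open>p\<close>-th power of the full norm.\<close>

definition Wsp_energy :: "real \<Rightarrow> real \<Rightarrow> ('a::euclidean_space \<Rightarrow> real) \<Rightarrow> ennreal" where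
  "Wsp_energy s p u = gagliardo_energy s p u + (\<integral>\<^sup>+x. ennreal (\<bar>u x\<bar> powr p) \<partial>lborel)"

text \<open>The completion of \<open>Cc_inf \<Omega>\<close>, realized as its closure in the complete space \<open>Wsp\<close>.\<close>

definition W0sp :: "real \<Rightarrow> real \<Rightarrow> 'a::euclidean_space set \<Rightarrow> ('a \<Rightarrow> real) set" where
  "W0sp s p \<Omega> = {u \<in> Wsp s p. \<exists>\<phi> :: nat \<Rightarrow> 'a \<Rightarrow> real.
      (\<forall>n. \<phi> n \<in> Cc_inf \<Omega>) \<and> (\<lambda>n. Wsp_energy s p (\<lambda>x. \<phi> n x - u x)) \<longlonglongrightarrow> 0}"

section \<open>The singular problem\<close>

definition frac_p_pairing ::
  "real \<Rightarrow> real \<Rightarrow> ('a::euclidean_space \<Rightarrow> real) \<Rightarrow> ('a \<Rightarrow> real) \<Rightarrow> real" where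
  "frac_p_pairing s p u v =
     (\<integral>(x, y). \<bar>u x - u y\<bar> powr (p - 2) * (u x - u y) * (v x - v y)
                / norm (x - y) powr (real DIM('a) + s * p) \<partial>(lborel \<Otimes>\<^sub>M lborel))"

text \<open>Positivity of \<open>u\<close> almost everywhere in \<open>\<Omega>\<close> is contained in the local lower bounds, and
  \<open>u = 0\<close> outside \<open>\<Omega>\<close> in the membership \<open>u \<in> W0sp s p \<Omega>\<close>.\<close>

definition weak_solution ::
  "real \<Rightarrow> real \<Rightarrow> 'a::euclidean_space set \<Rightarrow> real \<Rightarrow> ('a \<Rightarrow> real) \<Rightarrow> ('a \<Rightarrow> real) \<Rightarrow> bool" where
  "weak_solution s p \<Omega> \<alpha> \<omega> u \<longleftrightarrow>
     u \<in> W0sp s p \<Omega> \<and>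
     (\<forall>\<Omega>'. open \<Omega>' \<and> connected \<Omega>' \<and> compact (closure \<Omega>') \<and> closure \<Omega>' \<subseteq> \<Omega> \<longrightarrow>
        (\<exists>K>0. AE x in lborel. x \<in> \<Omega>' \<longrightarrow> K \<le> u x)) \<and>
     (\<forall>\<phi> \<in> Cc_inf \<Omega>.
        frac_p_pairing s p u \<phi> = (LINT x:\<Omega>|lborel. \<omega> x * \<phi> x / u x powr \<alpha>))"

definition hoelder_conj :: "real \<Rightarrow> real" where
  "hoelder_conj t = t / (t - 1)"

definition r_exponent :: "real \<Rightarrow> real \<Rightarrow> real \<Rightarrow> real \<Rightarrow> real" where
  "r_exponent N s p \<alpha> =
     (if s * p < N then hoelder_conj ((N * p / (N - s * p)) / (1 - \<alpha>)) else 1 / \<alpha>)"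

definition weighted_integral :: "'a::euclidean_space set \<Rightarrow> real \<Rightarrow> ('a \<Rightarrow> real) \<Rightarrow> ('a \<Rightarrow> real) \<Rightarrow> real"
  where "weighted_integral \<Omega> \<alpha> \<omega> v = (LINT x:\<Omega>|lborel. \<bar>v x\<bar> powr (1 - \<alpha>) * \<omega> x)"

definition constrained_energies ::
  "real \<Rightarrow> real \<Rightarrow> 'a::euclidean_space set \<Rightarrow> real \<Rightarrow> ('a \<Rightarrow> real) \<Rightarrow> real set" where
  "constrained_energies s p \<Omega> \<alpha> \<omega> =
     {gagliardo s p v powr p | v. v \<in> W0sp s p \<Omega> \<and> weighted_integral \<Omega> \<alpha> \<omega> v = 1}"

text \<open>This is a minimum if it belongs to \<open>constrained_energies\<close>, a set bounded below by \<open>0\<close>.\<close>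

definition lambda_min ::
  "real \<Rightarrow> real \<Rightarrow> 'a::euclidean_space set \<Rightarrow> real \<Rightarrow> ('a \<Rightarrow> real) \<Rightarrow> real" where
  "lambda_min s p \<Omega> \<alpha> \<omega> = Inf (constrained_energies s p \<Omega> \<alpha> \<omega>)"

end

theory Submission
  imports Defs
begin

text \<open>Let \<open>[v]\<close> denote the Gagliardo seminorm and \<open>u\<close> the weak solution. Testing the equation with
  regularized absolute values of test functions, and passing to the limit with Fatou's lemma, gives
  \<open>\<integral> \<omega> \<bar>v\<bar> / u powr \<alpha> \<le> [u] powr (p - 1) * [v]\<close> for all \<open>v\<close> in the space; approximating \<open>u\<close> itself by
  test functions gives \<open>\<integral> \<omega> u powr (1 - \<alpha>) = [u] powr p\<close>. Hoelder's inequality combines both into the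
  weighted inequality with constant \<open>[u] powr (p (1 - \<alpha> - p) / (1 - \<alpha>))\<close>, and
  equality holds for a multiple of u.\<close>

section \<open>Hoelder and Minkowski inequalities\<close>

text \<open>The obstacle is the singular term: the negative power of u is controlled only on compact
  subsets of \<Omega>, so the equation is tested with smooth compactly supported functions only, and
  u itself is not admissible. The way out is to bound the singular functional by the seminorm before
  extending it: on nonnegative test functions it is a nonnegative integral equal to the pairing, and
  Fatou's lemma, which asks for no integrability beforehand, carries the bound to the whole space.
  Being continuous, the functional then agrees with the pairing at the limit u too. The constant
  comes from counting powers of \<open>[u]\<close>: Hoelder yields
  \<open>[u] powr ((p - 1) * (1 - \<alpha>) + p * \<alpha>)\<close>, that is
  \<open>[u] powr (p - 1 + \<alpha>)\<close>; raising this to \<open>p / (1 - \<alpha>)\<close> and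
  dividing gives the stated exponent. No minimizing sequence is needed: the multiple of u with
  equality shows at once that the infimum is attained and that the constant is sharp.\<close>

lemma nn_integral_Hoelder:
  fixes f g :: "'b \<Rightarrow> real"
  assumes [measurable]: "f \<in> borel_measurable M" "g \<in> borel_measurable M"
    and f0: "\<And>x. 0 \<le> f x" and g0: "\<And>x. 0 \<le> g x"
    and \<theta>: "0 < \<theta>" "\<theta> < 1"
    and A: "(\<integral>\<^sup>+x. ennreal (f x) \<partial>M) \<le> ennreal A" "0 \<le> A"
    and B: "(\<integral>\<^sup>+x. ennreal (g x) \<partial>M) \<le> ennreal B" "0 \<le> B"
  shows "(\<integral>\<^sup>+x. ennreal (f x powr \<theta> * g x powr (1 - \<theta>)) \<partial>M) \<le> ennreal (A powr \<theta> * B powr (1 - \<theta>))"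
proof (cases "A = 0 \<or> B = 0")
  case True
  have "AE x in M. f x = 0 \<or> g x = 0"
  proof (cases "A = 0")
    case True
    then have "AE x in M. ennreal (f x) = 0"
      using A by (simp add: nn_integral_0_iff_AE)
    then show ?thesis by eventually_elim (use f0 in \<open>simp add: ennreal_eq_0_iff antisym\<close>)
  next
    case False
    then have "AE x in M. ennreal (g x) = 0"
      using B True by (simp add: nn_integral_0_iff_AE)
    then show ?thesis by eventually_elim (use g0 in \<open>simp add: ennreal_eq_0_iff antisym\<close>)
  qed
  then have "(\<integral>\<^sup>+x. ennreal (f x powr \<theta> * g x powr (1 - \<theta>)) \<partial>M) = (\<integral>\<^sup>+x. 0 \<partial>M)"
    by (intro nn_integral_cong_AE) (auto elim!: eventually_mono)
  then show ?thesis by simp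
next
  case False
  with A B have pos: "A > 0" "B > 0" by auto
  \<comment> \<open>\<open>c\<close> is the target bound. After the rescaling to
    \<open>f / A\<close> and \<open>g / B\<close>, Young's inequality integrates to at most
    \<open>c * \<theta> + c * (1 - \<theta>) = c\<close>; the division is why vanishing A or B is a
    separate case.\<close>
  define c where "c = A powr \<theta> * B powr (1 - \<theta>)"
  have c0: "c \<ge> 0" by (simp add: c_def)
  have pt: "f x powr \<theta> * g x powr (1 - \<theta>) \<le> c * \<theta> / A * f x + c * (1 - \<theta>) / B * g x" for x
  proof (cases "f x = 0 \<or> g x = 0")
    case True
    then show ?thesis using c0 pos \<theta> f0[of x] g0[of x] by auto
  next
    case False
    then have "f x / A > 0" "g x / B > 0" using pos f0[of x] g0[of x] by (auto simp: less_le)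
    then have "c * ((f x / A) powr \<theta> * (g x / B) powr (1 - \<theta>)) \<le> c * (\<theta> * (f x / A) + (1 - \<theta>) * (g x / B))"
      using \<theta> c0 by (intro mult_left_mono Youngs_inequality_0) auto
    moreover have "c * ((f x / A) powr \<theta> * (g x / B) powr (1 - \<theta>)) = f x powr \<theta> * g x powr (1 - \<theta>)"
      using pos by (simp add: c_def powr_divide f0 g0 field_simps)
    ultimately show ?thesis by (simp add: algebra_simps)
  qed
  have "(\<integral>\<^sup>+x. ennreal (f x powr \<theta> * g x powr (1 - \<theta>)) \<partial>M)
      \<le> (\<integral>\<^sup>+x. ennreal (c * \<theta> / A) * ennreal (f x) + ennreal (c * (1 - \<theta>) / B) * ennreal (g x) \<partial>M)"
    using pt pos c0 \<theta> f0 g0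
    by (intro nn_integral_mono) (simp add: ennreal_mult[symmetric] ennreal_plus[symmetric] del: ennreal_plus)
  also have "\<dots> = ennreal (c * \<theta> / A) * (\<integral>\<^sup>+x. ennreal (f x) \<partial>M) + ennreal (c * (1 - \<theta>) / B) * (\<integral>\<^sup>+x. ennreal (g x) \<partial>M)"
    by (simp add: nn_integral_add nn_integral_cmult)
  also have "\<dots> \<le> ennreal (c * \<theta> / A) * ennreal A + ennreal (c * (1 - \<theta>) / B) * ennreal B"
    by (intro add_mono mult_left_mono A B) auto
  also have "\<dots> = ennreal (c * \<theta> / A * A + c * (1 - \<theta>) / B * B)"
    using pos c0 \<theta> by (simp add: ennreal_mult[symmetric] ennreal_plus[symmetric] del: ennreal_plus)
  also have "c * \<theta> / A * A + c * (1 - \<theta>) / B * B = c"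
    using pos by (simp add: field_simps)
  finally show ?thesis by (simp add: c_def)
qed

text \<open>Convexity of the p-th power at the points \<open>\<bar>x\<bar> / A\<close> and
  \<open>\<bar>y\<bar> / B\<close> with weights \<open>A / (A + B)\<close> and
  \<open>B / (A + B)\<close>. The free parameters make it serve twice: with norms for A and B it
  integrates to Minkowski's inequality, with \<open>A = B = 1\<close> it gives the factor
  \<open>2 powr (p - 1)\<close>.\<close>

lemma powr_abs_add_le:
  fixes x y A B p :: real
  assumes "1 \<le> p" "0 < A" "0 < B"
  shows "\<bar>x + y\<bar> powr p \<le> (A + B) powr (p - 1) * (A powr (1 - p) * \<bar>x\<bar> powr p + B powr (1 - p) * \<bar>y\<bar> powr p)"
proof -
  define S where "S = A + B"
  have S: "S > 0" "A \<le> S" "B \<le> S" using assms by (auto simp: S_def)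
  \<comment> \<open>Convexity is applied to positive arguments only; this estimate covers the cases
    where x or y is zero.\<close>
  have one: "c powr p \<le> S powr (p - 1) * (D powr (1 - p) * c powr p)" if "0 < D" "D \<le> S" for c D :: real
  proof -
    have "1 \<le> (S / D) powr (p - 1)" using that assms by (intro ge_one_powr_ge_zero) auto
    also have "\<dots> = S powr (p - 1) * D powr (1 - p)"
      using that S powr_minus_divide[of D "p - 1"] by (simp add: powr_divide)
    finally have "1 * c powr p \<le> S powr (p - 1) * D powr (1 - p) * c powr p"
      by (intro mult_right_mono) auto
    then show ?thesis by (simp add: mult.assoc)
  qed
  consider "x = 0" | "y = 0" | "x \<noteq> 0" "y \<noteq> 0" by blast
  then show ?thesis
  proof cases
    case 3
    have AB: "A / S + B / S = 1" using S by (simp add: S_def add_divide_distrib[symmetric])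
    have "((A / S) *\<^sub>R (\<bar>x\<bar> / A) + (B / S) *\<^sub>R (\<bar>y\<bar> / B)) powr p
        \<le> (A / S) * (\<bar>x\<bar> / A) powr p + (B / S) * (\<bar>y\<bar> / B) powr p"
      by (rule conjunct2[OF powr_convex[OF assms(1), unfolded convex_on_def], rule_format])
         (use AB assms S 3 in auto)
    also have "(A / S) *\<^sub>R (\<bar>x\<bar> / A) + (B / S) *\<^sub>R (\<bar>y\<bar> / B) = (\<bar>x\<bar> + \<bar>y\<bar>) / S"
      using assms S by (simp add: field_simps)
    finally have 1: "((\<bar>x\<bar> + \<bar>y\<bar>) / S) powr p \<le> (A / S) * (\<bar>x\<bar> / A) powr p + (B / S) * (\<bar>y\<bar> / B) powr p" .
    have "\<bar>x + y\<bar> powr p \<le> (\<bar>x\<bar> + \<bar>y\<bar>) powr p"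
      using assms by (intro powr_mono2) auto
    also have "\<dots> = S powr p * ((\<bar>x\<bar> + \<bar>y\<bar>) / S) powr p"
      using S by (simp add: powr_divide)
    also have "\<dots> \<le> S powr p * ((A / S) * (\<bar>x\<bar> / A) powr p + (B / S) * (\<bar>y\<bar> / B) powr p)"
      using 1 by (intro mult_left_mono) auto
    also have "\<dots> = S powr (p - 1) * (A powr (1 - p) * \<bar>x\<bar> powr p + B powr (1 - p) * \<bar>y\<bar> powr p)"
      using assms S by (simp add: powr_divide powr_diff field_simps)
    finally show ?thesis by (simp add: S_def)
  qed (use one[of A "\<bar>x\<bar>"] one[of B "\<bar>y\<bar>"] assms S in \<open>auto simp: S_def\<close>)
qed

lemma nn_integral_Minkowski:
  fixes f g k :: "'b \<Rightarrow> real"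
  assumes [measurable]: "f \<in> borel_measurable M" "g \<in> borel_measurable M" "k \<in> borel_measurable M"
    and k0: "\<And>x. 0 \<le> k x" and p: "1 \<le> p"
    and A: "(\<integral>\<^sup>+x. ennreal (\<bar>f x\<bar> powr p * k x) \<partial>M) \<le> ennreal (A powr p)" "0 \<le> A"
    and B: "(\<integral>\<^sup>+x. ennreal (\<bar>g x\<bar> powr p * k x) \<partial>M) \<le> ennreal (B powr p)" "0 \<le> B"
  shows "(\<integral>\<^sup>+x. ennreal (\<bar>f x + g x\<bar> powr p * k x) \<partial>M) \<le> ennreal ((A + B) powr p)"
proof -
  \<comment> \<open>A or B may be zero, while the pointwise inequality contains the negative powers
    \<open>A powr (1 - p)\<close> and \<open>B powr (1 - p)\<close>. Hence both are enlarged by e,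
    which tends to 0 at the end.\<close>
  have eps: "(\<integral>\<^sup>+x. ennreal (\<bar>f x + g x\<bar> powr p * k x) \<partial>M) \<le> ennreal ((A + e + (B + e)) powr p)"
    if e: "e > 0" for e
  proof -
    define a b S where "a = A + e" and "b = B + e" and "S = a + b"
    have ab: "a > 0" "b > 0" "S > 0" using e A B by (auto simp: a_def b_def S_def)
    have "(\<integral>\<^sup>+x. ennreal (\<bar>f x + g x\<bar> powr p * k x) \<partial>M)
       \<le> (\<integral>\<^sup>+x. ennreal (S powr (p - 1) * a powr (1 - p)) * ennreal (\<bar>f x\<bar> powr p * k x)
             + ennreal (S powr (p - 1) * b powr (1 - p)) * ennreal (\<bar>g x\<bar> powr p * k x) \<partial>M)"
    proof (intro nn_integral_mono)
      fix x
      have "\<bar>f x + g x\<bar> powr p * k x \<le> (S powr (p - 1) * (a powr (1 - p) * \<bar>f x\<bar> powr p + b powr (1 - p) * \<bar>g x\<bar> powr p)) * k x"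
        unfolding S_def using powr_abs_add_le[OF p ab(1,2)] k0 by (intro mult_right_mono) auto
      then show "ennreal (\<bar>f x + g x\<bar> powr p * k x)
       \<le> ennreal (S powr (p - 1) * a powr (1 - p)) * ennreal (\<bar>f x\<bar> powr p * k x)
             + ennreal (S powr (p - 1) * b powr (1 - p)) * ennreal (\<bar>g x\<bar> powr p * k x)"
        using k0 by (simp add: ennreal_mult[symmetric] ennreal_plus[symmetric] algebra_simps del: ennreal_plus)
    qed
    also have "\<dots> = ennreal (S powr (p - 1) * a powr (1 - p)) * (\<integral>\<^sup>+x. ennreal (\<bar>f x\<bar> powr p * k x) \<partial>M)
             + ennreal (S powr (p - 1) * b powr (1 - p)) * (\<integral>\<^sup>+x. ennreal (\<bar>g x\<bar> powr p * k x) \<partial>M)"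
      by (simp add: nn_integral_add nn_integral_cmult)
    also have "\<dots> \<le> ennreal (S powr (p - 1) * a powr (1 - p)) * ennreal (a powr p)
             + ennreal (S powr (p - 1) * b powr (1 - p)) * ennreal (b powr p)"
      using A B e p
      by (intro add_mono mult_left_mono order_trans[OF A(1)] order_trans[OF B(1)] ennreal_leI powr_mono2)
         (auto simp: a_def b_def)
    also have "\<dots> = ennreal (S powr (p - 1) * a powr (1 - p) * a powr p + S powr (p - 1) * b powr (1 - p) * b powr p)"
      by (simp add: ennreal_mult[symmetric] ennreal_plus[symmetric] del: ennreal_plus)
    also have "S powr (p - 1) * a powr (1 - p) * a powr p + S powr (p - 1) * b powr (1 - p) * b powr p = S powr p"
    proof -
      have "a powr (1 - p) * a powr p = a" "b powr (1 - p) * b powr p = b"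
        using ab by (simp_all add: powr_add[symmetric])
      then have "S powr (p - 1) * a powr (1 - p) * a powr p + S powr (p - 1) * b powr (1 - p) * b powr p
           = S powr (p - 1) * S powr 1"
        using ab by (simp add: S_def mult.assoc distrib_left)
      also have "\<dots> = S powr p" by (simp only: powr_add[symmetric]) simp
      finally show ?thesis .
    qed
    finally show ?thesis by (simp add: S_def a_def b_def)
  qed
  have "((\<lambda>e. ennreal ((A + e + (B + e)) powr p)) \<longlongrightarrow> ennreal ((A + 0 + (B + 0)) powr p)) (at_right 0)"
    using p A(2) B(2)
    by (intro tendsto_ennrealI tendsto_powr' tendsto_intros) (auto intro!: eventually_mono[OF eventually_at_right_less])
  moreover have "\<forall>\<^sub>F e in at_right (0::real). (\<integral>\<^sup>+x. ennreal (\<bar>f x + g x\<bar> powr p * k x) \<partial>M) \<le> ennreal ((A + e + (B + e)) powr p)"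
    using eps by (rule eventually_mono[OF eventually_at_right_less])
  ultimately show ?thesis
    by (intro tendsto_lowerbound[where F="at_right (0::real)"]) auto
qed

text \<open>Convergence to 0 in the p-th mean is convergence in L1 of the p-th powers, so the almost
  everywhere convergent subsequence for L1 applies; a p-th root returns to f.\<close>

lemma tendsto_AE_subseq_powr:
  fixes f :: "nat \<Rightarrow> 'b \<Rightarrow> real"
  assumes [measurable]: "\<And>n. f n \<in> borel_measurable M" and p: "0 < p"
    and lim: "(\<lambda>n. \<integral>\<^sup>+x. ennreal (\<bar>f n x\<bar> powr p) \<partial>M) \<longlonglongrightarrow> 0"
    and fin: "\<And>n. (\<integral>\<^sup>+x. ennreal (\<bar>f n x\<bar> powr p) \<partial>M) < \<infinity>"
  obtains r :: "nat \<Rightarrow> nat" where "strict_mono r" "AE x in M. (\<lambda>n. f (r n) x) \<longlonglongrightarrow> 0"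
proof -
  have int: "integrable M (\<lambda>x. \<bar>f n x\<bar> powr p)" for n
    using fin[of n] by (intro integrableI_nonneg) auto
  have eq: "(\<integral>x. norm (\<bar>f n x\<bar> powr p) \<partial>M) = enn2real (\<integral>\<^sup>+x. ennreal (\<bar>f n x\<bar> powr p) \<partial>M)" for n
    by (subst integral_eq_nn_integral) auto
  have "(\<lambda>n. (\<integral>x. norm (\<bar>f n x\<bar> powr p) \<partial>M)) \<longlonglongrightarrow> 0"
    unfolding eq using tendsto_enn2real[of _ 0] lim by simp
  from tendsto_L1_AE_subseq[OF int this] obtain r where r: "strict_mono r"
    "AE x in M. (\<lambda>n. \<bar>f (r n) x\<bar> powr p) \<longlonglongrightarrow> 0" by blast
  have "AE x in M. (\<lambda>n. f (r n) x) \<longlonglongrightarrow> 0"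
    using r(2)
  proof eventually_elim
    case (elim x)
    have "(\<lambda>n. (\<bar>f (r n) x\<bar> powr p) powr (1 / p)) \<longlonglongrightarrow> 0 powr (1 / p)"
      using p by (intro tendsto_powr' elim tendsto_intros) auto
    then have "(\<lambda>n. \<bar>f (r n) x\<bar>) \<longlonglongrightarrow> 0" using p by (simp add: powr_powr)
    then show ?case by (rule tendsto_rabs_zero_cancel)
  qed
  with r(1) that show ?thesis by blast
qed

section \<open>Calculus of smooth functions\<close>

text \<open>Needed for the product and power rules, whose derivatives again contain the
  undifferentiated functions.\<close>

lemma Ck_on_SucD: "Ck_on (Suc k) f S \<Longrightarrow> Ck_on k f S"
proof (induction k arbitrary: f)
  case 0
  then show ?case
    by (auto intro!: continuous_at_imp_continuous_on differentiable_imp_continuous_within)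
next
  case (Suc k)
  then show ?case by (metis Ck_on.simps(2))
qed

lemma Ck_on_const: "Ck_on k (\<lambda>x. c) UNIV"
  by (induction k arbitrary: c) auto

lemma Ck_on_add:
  "Ck_on k f UNIV \<Longrightarrow> Ck_on k g UNIV \<Longrightarrow> Ck_on k (\<lambda>x. f x + g x) UNIV"
proof (induction k arbitrary: f g)
  case (Suc k)
  have "frechet_derivative (\<lambda>x. f x + g x) (at x) h
      = frechet_derivative f (at x) h + frechet_derivative g (at x) h" for x h
    using Suc.prems by (intro frechet_derivative_at[symmetric, THEN fun_cong])
      (auto intro!: has_derivative_add simp: frechet_derivative_works[symmetric])
  with Suc show ?case by (auto intro!: differentiable_add)
qed (auto intro!: continuous_intros)

lemma Ck_on_mult:
  "Ck_on k f UNIV \<Longrightarrow> Ck_on k g UNIV \<Longrightarrow> Ck_on k (\<lambda>x. f x * g x) UNIV"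
proof (induction k arbitrary: f g)
  case (Suc k)
  have "frechet_derivative (\<lambda>x. f x * g x) (at x) h
      = f x * frechet_derivative g (at x) h + frechet_derivative f (at x) h * g x" for x h
    using Suc.prems by (intro frechet_derivative_at[symmetric, THEN fun_cong])
      (auto intro!: has_derivative_mult simp: frechet_derivative_works[symmetric])
  with Suc.IH Suc.prems Ck_on_SucD[OF Suc.prems(1)] Ck_on_SucD[OF Suc.prems(2)] show ?case
    by (auto intro!: differentiable_mult Ck_on_add)
qed (auto intro!: continuous_intros)

lemma Ck_on_diff:
  "Ck_on k f UNIV \<Longrightarrow> Ck_on k g UNIV \<Longrightarrow> Ck_on k (\<lambda>x. f x - g x) UNIV"
  using Ck_on_add[of k f "\<lambda>x. (- 1) * g x"] Ck_on_mult[OF Ck_on_const[of k "- 1"], of g] by simp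

text \<open>The derivative contains the power \<open>a - 1\<close>, so the induction must leave the
  exponent arbitrary. Positivity of f keeps all these powers smooth.\<close>

lemma Ck_on_powr:
  assumes pos: "\<And>x. 0 < f x"
  shows "Ck_on k f UNIV \<Longrightarrow> Ck_on k (\<lambda>x. f x powr a) UNIV"
proof (induction k arbitrary: a)
  case 0
  then show ?case using pos by (auto intro!: continuous_intros simp: less_imp_neq[THEN not_sym])
next
  case (Suc k)
  have der: "((\<lambda>x. f x powr a) has_derivative
      (\<lambda>h. a * f x powr (a - 1) * frechet_derivative f (at x) h)) (at x)" for x
  proof -
    have "(f has_derivative frechet_derivative f (at x)) (at x)"
      using Suc.prems by (auto simp: frechet_derivative_works[symmetric])
    from has_derivative_powr[OF this has_derivative_const[of a], OF pos UNIV_I]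
    show ?thesis using pos[of x] by (simp add: powr_diff mult_ac)
  qed
  have "frechet_derivative (\<lambda>x. f x powr a) (at x) h
      = a * f x powr (a - 1) * frechet_derivative f (at x) h" for x h
    using der by (intro frechet_derivative_at[symmetric, THEN fun_cong])
  with der Suc.IH[OF Ck_on_SucD[OF Suc.prems]] Suc.prems show ?case
    by (auto simp: differentiable_def intro!: Ck_on_mult Ck_on_const)
qed

lemma Cc_inf_continuous: "\<phi> \<in> Cc_inf \<Omega> \<Longrightarrow> continuous_on UNIV \<phi>"
  unfolding Cc_inf_def Cinf_on_def by (metis (mono_tags, lifting) Ck_on.simps(1) mem_Collect_eq)

lemma Cc_inf_borel: "\<phi> \<in> Cc_inf \<Omega> \<Longrightarrow> \<phi> \<in> borel_measurable borel"
  by (intro borel_measurable_continuous_onI Cc_inf_continuous)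

text \<open>Two reference functions are allowed so that differences are covered; for multiples and
  for \<open>smooth_abs\<close> both are the same function.\<close>

lemma Cc_inf_support:
  assumes g: "\<And>k. Ck_on k g UNIV" and \<phi>: "\<phi> \<in> Cc_inf \<Omega>" and \<psi>: "\<psi> \<in> Cc_inf \<Omega>"
    and sub: "\<And>x. g x \<noteq> 0 \<Longrightarrow> \<phi> x \<noteq> 0 \<or> \<psi> x \<noteq> 0"
  shows "g \<in> Cc_inf \<Omega>"
proof -
  have le: "closure {x. g x \<noteq> 0} \<subseteq> closure {x. \<phi> x \<noteq> 0} \<union> closure {x. \<psi> x \<noteq> 0}"
    unfolding closure_Un[symmetric] using sub by (intro closure_mono) blast
  have "compact (closure {x. \<phi> x \<noteq> 0} \<union> closure {x. \<psi> x \<noteq> 0})"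
    using \<phi> \<psi> unfolding Cc_inf_def by blast
  from compact_Int_closed[OF this closed_closure] have "compact (closure {x. g x \<noteq> 0})"
    by (metis le inf.absorb2)
  moreover have "closure {x. g x \<noteq> 0} \<subseteq> \<Omega>"
    using le \<phi> \<psi> unfolding Cc_inf_def by blast
  ultimately show ?thesis using g unfolding Cc_inf_def Cinf_on_def by blast
qed

lemma Cc_inf_Ck: "\<phi> \<in> Cc_inf \<Omega> \<Longrightarrow> Ck_on k \<phi> UNIV"
  by (simp add: Cc_inf_def Cinf_on_def)

lemma Cc_inf_diff:
  assumes "\<phi> \<in> Cc_inf \<Omega>" "\<psi> \<in> Cc_inf \<Omega>"
  shows "(\<lambda>x. \<phi> x - \<psi> x) \<in> Cc_inf \<Omega>"
  by (rule Cc_inf_support[OF _ assms]) (auto intro!: Ck_on_diff Cc_inf_Ck[OF assms(1)] Cc_inf_Ck[OF assms(2)])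

lemma Cc_inf_cmult:
  assumes "\<phi> \<in> Cc_inf \<Omega>"
  shows "(\<lambda>x. c * \<phi> x) \<in> Cc_inf \<Omega>"
  by (rule Cc_inf_support[OF _ assms assms]) (auto intro!: Ck_on_mult Ck_on_const Cc_inf_Ck[OF assms])

section \<open>Smooth regularization of the absolute value\<close>

text \<open>The root is smooth because its argument stays away from 0. Subtracting \<epsilon> makes
  the function vanish at 0, so that composition with it preserves compact support.\<close>

definition smooth_abs :: "real \<Rightarrow> real \<Rightarrow> real" where
  "smooth_abs \<epsilon> t = sqrt (t\<^sup>2 + \<epsilon>\<^sup>2) - \<epsilon>"

lemma smooth_abs_nonneg: "0 \<le> smooth_abs \<epsilon> t"
  unfolding smooth_abs_def using real_le_rsqrt[of "\<epsilon>" "t\<^sup>2 + \<epsilon>\<^sup>2"] by simp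

lemma smooth_abs_eq_0_iff: "\<epsilon> > 0 \<Longrightarrow> smooth_abs \<epsilon> t = 0 \<longleftrightarrow> t = 0"
  unfolding smooth_abs_def using real_sqrt_eq_iff[of "t\<^sup>2 + \<epsilon>\<^sup>2" "\<epsilon>\<^sup>2"] by simp

lemma smooth_abs_lipschitz: "\<bar>smooth_abs \<epsilon> t - smooth_abs \<epsilon> t'\<bar> \<le> \<bar>t - t'\<bar>"
proof -
  \<comment> \<open>The root is the Euclidean norm of the pair \<open>(t, \<epsilon>)\<close>, so
    the Lipschitz constant 1 is the reverse triangle inequality.\<close>
  have "\<bar>norm (t, \<epsilon>) - norm (t', \<epsilon>)\<bar> \<le> norm ((t, \<epsilon>) - (t', \<epsilon>))"
    by (rule norm_triangle_ineq3)
  then show ?thesis by (simp add: smooth_abs_def norm_Pair)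
qed

lemma smooth_abs_tendsto:
  assumes "(\<epsilon> \<longlongrightarrow> 0) F" shows "((\<lambda>n. smooth_abs (\<epsilon> n) t) \<longlongrightarrow> \<bar>t\<bar>) F"
proof -
  have "((\<lambda>n. smooth_abs (\<epsilon> n) t) \<longlongrightarrow> sqrt (t\<^sup>2 + 0\<^sup>2) - 0) F"
    unfolding smooth_abs_def by (intro tendsto_intros assms)
  then show ?thesis by simp
qed

lemma Cc_inf_smooth_abs:
  assumes "\<phi> \<in> Cc_inf \<Omega>" "\<epsilon> > 0"
  shows "(\<lambda>x. smooth_abs \<epsilon> (\<phi> x)) \<in> Cc_inf \<Omega>"
proof -
  have pos: "0 < \<phi> x * \<phi> x + \<epsilon>\<^sup>2" for x using assms(2) by (simp add: add_nonneg_pos)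
  have eq: "smooth_abs \<epsilon> (\<phi> x) = (\<phi> x * \<phi> x + \<epsilon>\<^sup>2) powr (1 / 2) - \<epsilon>" for x
    using pos[of x] by (simp add: smooth_abs_def powr_half_sqrt power2_eq_square)
  have "Ck_on k (\<lambda>x. smooth_abs \<epsilon> (\<phi> x)) UNIV" for k
    unfolding eq
    by (intro Ck_on_diff Ck_on_powr Ck_on_add Ck_on_mult Ck_on_const pos Cc_inf_Ck[OF assms(1)])
  then show ?thesis
    by (rule Cc_inf_support[OF _ assms(1) assms(1)]) (simp add: smooth_abs_eq_0_iff assms(2))
qed

section \<open>The Gagliardo energy\<close>

text \<open>Separating the kernel turns the energy into a weighted p-th power integral of
  \<open>u (fst z) - u (snd z)\<close> over the product space, the form in which Hoelder's and
  Minkowski's inequalities apply. On the diagonal its value is \<open>1 / 0 = 0\<close>.\<close>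

definition gagliardo_kernel :: "real \<Rightarrow> real \<Rightarrow> 'a::euclidean_space \<times> 'a \<Rightarrow> real" where
  "gagliardo_kernel s p z = 1 / norm (fst z - snd z) powr (real DIM('a) + s * p)"

lemma gagliardo_kernel_nonneg [simp]: "0 \<le> gagliardo_kernel s p z"
  by (simp add: gagliardo_kernel_def)

lemma gagliardo_kernel_borel [measurable]:
  "gagliardo_kernel s p \<in> borel_measurable (lborel \<Otimes>\<^sub>M (lborel :: 'a::euclidean_space measure))"
  unfolding gagliardo_kernel_def[abs_def] by measurable

lemma gagliardo_energy_eq:
  fixes u :: "'a::euclidean_space \<Rightarrow> real"
  shows "gagliardo_energy s p u = (\<integral>\<^sup>+z. ennreal (\<bar>u (fst z) - u (snd z)\<bar> powr p * gagliardo_kernel s p z)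
    \<partial>(lborel \<Otimes>\<^sub>M lborel))"
  by (simp add: gagliardo_energy_def gagliardo_kernel_def case_prod_unfold)

lemma gagliardo_energy_mono:
  assumes "\<And>x y. \<bar>u x - u y\<bar> \<le> \<bar>v x - v y\<bar>" "0 \<le> p"
  shows "gagliardo_energy s p u \<le> gagliardo_energy s p v"
  unfolding gagliardo_energy_eq using assms
  by (intro nn_integral_mono ennreal_leI mult_right_mono powr_mono2) auto

lemma gagliardo_nonneg [simp]: "0 \<le> gagliardo s p u"
  by (simp add: gagliardo_def)

lemma gagliardo_powr: "p > 0 \<Longrightarrow> gagliardo s p u powr p = enn2real (gagliardo_energy s p u)"
  by (simp add: gagliardo_def powr_powr)

lemma gagliardo_energy_powr:
  "p > 0 \<Longrightarrow> gagliardo_energy s p u < \<infinity> \<Longrightarrow> gagliardo_energy s p u = ennreal (gagliardo s p u powr p)"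
  by (simp add: gagliardo_powr less_top)

lemma gagliardo_mono:
  assumes "\<And>x y. \<bar>u x - u y\<bar> \<le> \<bar>v x - v y\<bar>" "0 < p" "gagliardo_energy s p v < \<infinity>"
  shows "gagliardo s p u \<le> gagliardo s p v"
  unfolding gagliardo_def using assms gagliardo_energy_mono[of u v p s]
  by (intro powr_mono2 enn2real_mono) auto

lemma gagliardo_triangle:
  fixes u v :: "'a::euclidean_space \<Rightarrow> real"
  assumes [measurable]: "u \<in> borel_measurable borel" "v \<in> borel_measurable borel"
    and p: "1 \<le> p" and fin: "gagliardo_energy s p u < \<infinity>" "gagliardo_energy s p v < \<infinity>"
  shows "gagliardo s p (\<lambda>x. u x + v x) \<le> gagliardo s p u + gagliardo s p v"
proof -
  have "gagliardo_energy s p (\<lambda>x. u x + v x)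
      \<le> ennreal ((gagliardo s p u + gagliardo s p v) powr p)"
    \<comment> \<open>The difference of the sum at two points is regrouped as the sum of the two
      differences, to which Minkowski's inequality applies with the kernel as weight.\<close>
    unfolding gagliardo_energy_eq add_diff_add
  proof (rule nn_integral_Minkowski)
    show "(\<integral>\<^sup>+z. ennreal (\<bar>u (fst z) - u (snd z)\<bar> powr p * gagliardo_kernel s p z) \<partial>(lborel \<Otimes>\<^sub>M lborel))
        \<le> ennreal (gagliardo s p u powr p)"
      unfolding gagliardo_energy_eq[symmetric] using p fin(1) by (subst gagliardo_energy_powr) auto
    show "(\<integral>\<^sup>+z. ennreal (\<bar>v (fst z) - v (snd z)\<bar> powr p * gagliardo_kernel s p z) \<partial>(lborel \<Otimes>\<^sub>M lborel))
        \<le> ennreal (gagliardo s p v powr p)"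
      unfolding gagliardo_energy_eq[symmetric] using p fin(2) by (subst gagliardo_energy_powr) auto
  qed (use p in auto)
  then have "enn2real (gagliardo_energy s p (\<lambda>x. u x + v x)) \<le> (gagliardo s p u + gagliardo s p v) powr p"
    by (simp add: enn2real_leI)
  then have "gagliardo s p (\<lambda>x. u x + v x) \<le> ((gagliardo s p u + gagliardo s p v) powr p) powr (1 / p)"
    unfolding gagliardo_def[of s p "\<lambda>x. u x + v x"] using p by (intro powr_mono2) auto
  then show ?thesis using p by (simp add: powr_powr)
qed

text \<open>Weaker than Minkowski's inequality, but it stays valid for infinite integrals and
  involves no roots, so that it can be added up over the two parts of
  \<open>Wsp_energy\<close>.\<close>

lemma nn_integral_powr_add_le:
  fixes f g k :: "'b \<Rightarrow> real"
  assumes [measurable]: "f \<in> borel_measurable M" "g \<in> borel_measurable M" "k \<in> borel_measurable M"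
    and k0: "\<And>x. 0 \<le> k x" and p: "1 \<le> p"
  shows "(\<integral>\<^sup>+x. ennreal (\<bar>f x + g x\<bar> powr p * k x) \<partial>M) \<le> ennreal (2 powr (p - 1)) *
    ((\<integral>\<^sup>+x. ennreal (\<bar>f x\<bar> powr p * k x) \<partial>M) + (\<integral>\<^sup>+x. ennreal (\<bar>g x\<bar> powr p * k x) \<partial>M))"
proof -
  have "(\<integral>\<^sup>+x. ennreal (\<bar>f x + g x\<bar> powr p * k x) \<partial>M)
     \<le> (\<integral>\<^sup>+x. ennreal (2 powr (p - 1)) * (ennreal (\<bar>f x\<bar> powr p * k x) + ennreal (\<bar>g x\<bar> powr p * k x)) \<partial>M)"
  proof (intro nn_integral_mono)
    fix x
    have "\<bar>f x + g x\<bar> powr p * k x \<le> (2 powr (p - 1) * (\<bar>f x\<bar> powr p + \<bar>g x\<bar> powr p)) * k x"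
      using powr_abs_add_le[OF p, of 1 1 "f x" "g x"] k0 by (intro mult_right_mono) auto
    then show "ennreal (\<bar>f x + g x\<bar> powr p * k x)
       \<le> ennreal (2 powr (p - 1)) * (ennreal (\<bar>f x\<bar> powr p * k x) + ennreal (\<bar>g x\<bar> powr p * k x))"
      using k0 by (simp add: ennreal_mult[symmetric] ennreal_plus[symmetric] algebra_simps del: ennreal_plus)
  qed
  also have "\<dots> = ennreal (2 powr (p - 1)) *
    ((\<integral>\<^sup>+x. ennreal (\<bar>f x\<bar> powr p * k x) \<partial>M) + (\<integral>\<^sup>+x. ennreal (\<bar>g x\<bar> powr p * k x) \<partial>M))"
    by (simp add: nn_integral_add nn_integral_cmult)
  finally show ?thesis .
qed

lemma Wsp_energy_add_le:
  fixes u v :: "'a::euclidean_space \<Rightarrow> real"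
  assumes [measurable]: "u \<in> borel_measurable borel" "v \<in> borel_measurable borel" and p: "1 \<le> p"
  shows "Wsp_energy s p (\<lambda>x. u x + v x) \<le> ennreal (2 powr (p - 1)) * (Wsp_energy s p u + Wsp_energy s p v)"
proof -
  have "gagliardo_energy s p (\<lambda>x. u x + v x)
      \<le> ennreal (2 powr (p - 1)) * (gagliardo_energy s p u + gagliardo_energy s p v)"
    unfolding gagliardo_energy_eq
    using nn_integral_powr_add_le[of "\<lambda>z. u (fst z) - u (snd z)" "lborel \<Otimes>\<^sub>M lborel" "\<lambda>z. v (fst z) - v (snd z)"
        "gagliardo_kernel s p" p] p by (simp add: add_diff_add)
  moreover have "(\<integral>\<^sup>+x. ennreal (\<bar>u x + v x\<bar> powr p) \<partial>lborel) \<le> ennreal (2 powr (p - 1)) *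
      ((\<integral>\<^sup>+x. ennreal (\<bar>u x\<bar> powr p) \<partial>lborel) + (\<integral>\<^sup>+x. ennreal (\<bar>v x\<bar> powr p) \<partial>lborel))"
    using nn_integral_powr_add_le[of u lborel v "\<lambda>_. 1" p] p by simp
  ultimately have "Wsp_energy s p (\<lambda>x. u x + v x)
      \<le> ennreal (2 powr (p - 1)) * (gagliardo_energy s p u + gagliardo_energy s p v) +
        ennreal (2 powr (p - 1)) *
          ((\<integral>\<^sup>+x. ennreal (\<bar>u x\<bar> powr p) \<partial>lborel) + (\<integral>\<^sup>+x. ennreal (\<bar>v x\<bar> powr p) \<partial>lborel))"
    unfolding Wsp_energy_def by (rule add_mono)
  then show ?thesis by (simp add: Wsp_energy_def distrib_left add_ac)
qed

lemma gagliardo_energy_cmult: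
  fixes u :: "'a::euclidean_space \<Rightarrow> real"
  assumes [measurable]: "u \<in> borel_measurable borel"
  shows "gagliardo_energy s p (\<lambda>x. c * u x) = ennreal (\<bar>c\<bar> powr p) * gagliardo_energy s p u"
  unfolding gagliardo_energy_eq
  by (subst nn_integral_cmult[symmetric])
     (auto simp: ennreal_mult[symmetric] right_diff_distrib[symmetric] abs_mult powr_mult mult_ac)

lemma Wsp_energy_cmult:
  fixes u :: "'a::euclidean_space \<Rightarrow> real"
  assumes [measurable]: "u \<in> borel_measurable borel"
  shows "Wsp_energy s p (\<lambda>x. c * u x) = ennreal (\<bar>c\<bar> powr p) * Wsp_energy s p u"
  unfolding Wsp_energy_def
  by (simp add: gagliardo_energy_cmult distrib_left nn_integral_cmult[symmetric] ennreal_mult[symmetric] abs_mult powr_mult)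

lemma gagliardo_cmult:
  assumes "u \<in> borel_measurable borel" "p > 0"
  shows "gagliardo s p (\<lambda>x. c * u x) = \<bar>c\<bar> * gagliardo s p u"
  using assms by (simp add: gagliardo_def gagliardo_energy_cmult enn2real_mult powr_mult powr_powr)

section \<open>Linear structure of the Sobolev spaces and approximation by test functions\<close>

lemma Wsp_iff: "u \<in> Wsp s p \<longleftrightarrow> u \<in> borel_measurable borel \<and> Wsp_energy s p u < \<infinity>"
  by (auto simp: Wsp_def in_Lp_def Wsp_energy_def)

lemma Wsp_borel: "u \<in> Wsp s p \<Longrightarrow> u \<in> borel_measurable borel"
  and Wsp_gagliardo_finite: "u \<in> Wsp s p \<Longrightarrow> gagliardo_energy s p u < \<infinity>"
  by (simp_all add: Wsp_def in_Lp_def)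

lemma Wsp_cmult: "u \<in> Wsp s p \<Longrightarrow> (\<lambda>x. c * u x) \<in> Wsp s p"
  by (auto simp: Wsp_iff Wsp_energy_cmult ennreal_mult_less_top)

lemma Wsp_add: "1 \<le> p \<Longrightarrow> u \<in> Wsp s p \<Longrightarrow> v \<in> Wsp s p \<Longrightarrow> (\<lambda>x. u x + v x) \<in> Wsp s p"
  using Wsp_energy_add_le[of u v p s]
  by (auto simp: Wsp_iff ennreal_mult_less_top intro: order.strict_trans1)

lemma Wsp_diff: "1 \<le> p \<Longrightarrow> u \<in> Wsp s p \<Longrightarrow> v \<in> Wsp s p \<Longrightarrow> (\<lambda>x. u x - v x) \<in> Wsp s p"
  using Wsp_add[of p u s "\<lambda>x. (- 1) * v x"] Wsp_cmult[of v s p "- 1"] by simp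

lemma W0sp_Wsp: "u \<in> W0sp s p \<Omega> \<Longrightarrow> u \<in> Wsp s p"
  by (simp add: W0sp_def)

lemma W0spI:
  assumes "u \<in> Wsp s p" "\<And>n. \<phi> n \<in> Cc_inf \<Omega>" "(\<lambda>n. Wsp_energy s p (\<lambda>x. \<phi> n x - u x)) \<longlonglongrightarrow> 0"
  shows "u \<in> W0sp s p \<Omega>"
  unfolding W0sp_def using assms by blast

text \<open>The approximating test functions can be taken of finite energy: once
  \<open>\<phi> n - u\<close> has energy below 1, the function \<open>\<phi> n\<close> is a sum of
  two elements of \<open>Wsp\<close>, and the initial segment is dropped. No energy of a test
  function has to be computed.\<close>

lemma W0spE:
  assumes u: "u \<in> W0sp s p \<Omega>" and p: "1 \<le> p"
  obtains \<phi> :: "nat \<Rightarrow> 'a::euclidean_space \<Rightarrow> real"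
  where "\<And>n. \<phi> n \<in> Cc_inf \<Omega>" "\<And>n. \<phi> n \<in> Wsp s p"
    "(\<lambda>n. Wsp_energy s p (\<lambda>x. \<phi> n x - u x)) \<longlonglongrightarrow> 0"
proof -
  from u obtain \<phi> :: "nat \<Rightarrow> 'a \<Rightarrow> real" where \<phi>: "\<And>n. \<phi> n \<in> Cc_inf \<Omega>"
    "(\<lambda>n. Wsp_energy s p (\<lambda>x. \<phi> n x - u x)) \<longlonglongrightarrow> 0" by (auto simp: W0sp_def)
  have [measurable]: "u \<in> borel_measurable borel" using W0sp_Wsp[OF u] by (rule Wsp_borel)
  have [measurable]: "\<phi> n \<in> borel_measurable borel" for n using \<phi>(1) by (rule Cc_inf_borel)
  from order_tendstoD(2)[OF \<phi>(2), of 1] obtain m where m: "\<And>n. n \<ge> m \<Longrightarrow> Wsp_energy s p (\<lambda>x. \<phi> n x - u x) < 1"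
    by (auto simp: eventually_sequentially)
  have "\<phi> (n + m) \<in> Wsp s p" for n
  proof -
    have "(\<lambda>x. \<phi> (n + m) x - u x) \<in> Wsp s p"
      using m[of "n + m"] by (auto simp: Wsp_iff intro: order.strict_trans)
    from Wsp_add[OF p this W0sp_Wsp[OF u]] show ?thesis by simp
  qed
  then show ?thesis
    using that[of "\<lambda>n. \<phi> (n + m)"] \<phi>(1) LIMSEQ_ignore_initial_segment[OF \<phi>(2), of m] by simp
qed

lemma Cc_inf_in_W0sp: "\<phi> \<in> Cc_inf \<Omega> \<Longrightarrow> \<phi> \<in> Wsp s p \<Longrightarrow> \<phi> \<in> W0sp s p \<Omega>"
  by (rule W0spI[where \<phi>="\<lambda>_. \<phi>"]) (simp_all add: Wsp_energy_def gagliardo_energy_def case_prod_unfold)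

lemma W0sp_cmult:
  assumes u: "u \<in> W0sp s p \<Omega>"
  shows "(\<lambda>x. c * u x) \<in> W0sp s p \<Omega>"
proof -
  from u obtain \<phi> :: "nat \<Rightarrow> 'a \<Rightarrow> real" where \<phi>: "\<And>n. \<phi> n \<in> Cc_inf \<Omega>"
    "(\<lambda>n. Wsp_energy s p (\<lambda>x. \<phi> n x - u x)) \<longlonglongrightarrow> 0" by (auto simp: W0sp_def)
  have [measurable]: "u \<in> borel_measurable borel" using W0sp_Wsp[OF u] by (rule Wsp_borel)
  have [measurable]: "\<phi> n \<in> borel_measurable borel" for n using \<phi>(1) by (rule Cc_inf_borel)
  have "(\<lambda>n. ennreal (\<bar>c\<bar> powr p) * Wsp_energy s p (\<lambda>x. \<phi> n x - u x)) \<longlonglongrightarrow> ennreal (\<bar>c\<bar> powr p) * 0"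
    by (intro ennreal_tendsto_cmult \<phi>) auto
  moreover have "Wsp_energy s p (\<lambda>x. c * \<phi> n x - c * u x) = ennreal (\<bar>c\<bar> powr p) * Wsp_energy s p (\<lambda>x. \<phi> n x - u x)" for n
    using Wsp_energy_cmult[of "\<lambda>x. \<phi> n x - u x" s p c] by (simp add: right_diff_distrib)
  ultimately have "(\<lambda>n. Wsp_energy s p (\<lambda>x. c * \<phi> n x - c * u x)) \<longlonglongrightarrow> 0"
    by simp
  then show ?thesis
    by (intro W0spI[where \<phi>="\<lambda>n x. c * \<phi> n x"] Cc_inf_cmult \<phi> Wsp_cmult W0sp_Wsp[OF u])
qed

lemma W0sp_diff:
  assumes u: "u \<in> W0sp s p \<Omega>" and v: "v \<in> W0sp s p \<Omega>" and p: "1 \<le> p"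
  shows "(\<lambda>x. u x - v x) \<in> W0sp s p \<Omega>"
proof -
  from W0spE[OF u p] obtain \<phi> where \<phi>: "\<And>n. \<phi> n \<in> Cc_inf \<Omega>" "\<And>n. \<phi> n \<in> Wsp s p"
    "(\<lambda>n. Wsp_energy s p (\<lambda>x. \<phi> n x - u x)) \<longlonglongrightarrow> 0" by blast
  from W0spE[OF v p] obtain \<psi> where \<psi>: "\<And>n. \<psi> n \<in> Cc_inf \<Omega>" "\<And>n. \<psi> n \<in> Wsp s p"
    "(\<lambda>n. Wsp_energy s p (\<lambda>x. \<psi> n x - v x)) \<longlonglongrightarrow> 0" by blast
  note [measurable] = Wsp_borel[OF W0sp_Wsp[OF u]] Wsp_borel[OF W0sp_Wsp[OF v]]
    Wsp_borel[OF \<phi>(2)] Wsp_borel[OF \<psi>(2)]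
  have lim: "(\<lambda>n. ennreal (2 powr (p - 1)) * (Wsp_energy s p (\<lambda>x. \<phi> n x - u x) + Wsp_energy s p (\<lambda>x. \<psi> n x - v x)))
      \<longlonglongrightarrow> ennreal (2 powr (p - 1)) * (0 + 0)"
    by (intro ennreal_tendsto_cmult tendsto_add \<phi> \<psi>) auto
  have le: "Wsp_energy s p (\<lambda>x. \<phi> n x - \<psi> n x - (u x - v x))
     \<le> ennreal (2 powr (p - 1)) * (Wsp_energy s p (\<lambda>x. \<phi> n x - u x) + Wsp_energy s p (\<lambda>x. \<psi> n x - v x))" for n
  proof -
    have "(\<lambda>x. \<phi> n x - \<psi> n x - (u x - v x)) = (\<lambda>x. \<phi> n x - u x + (- 1) * (\<psi> n x - v x))"
      by auto
    moreover have "Wsp_energy s p (\<lambda>x. (- 1) * (\<psi> n x - v x)) = Wsp_energy s p (\<lambda>x. \<psi> n x - v x)"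
      by (subst Wsp_energy_cmult) auto
    ultimately show ?thesis
      using Wsp_energy_add_le[of "\<lambda>x. \<phi> n x - u x" "\<lambda>x. (- 1) * (\<psi> n x - v x)" p s] p by simp
  qed
  have "(\<lambda>n. Wsp_energy s p (\<lambda>x. \<phi> n x - \<psi> n x - (u x - v x))) \<longlonglongrightarrow> 0"
    by (rule tendsto_sandwich[OF _ always_eventually tendsto_const lim[unfolded add_0 mult_zero_right]])
       (simp_all only: le zero_le eventually_True simp_thms)
  then show ?thesis
    by (intro W0spI[where \<phi>="\<lambda>n x. \<phi> n x - \<psi> n x"] Cc_inf_diff \<phi> \<psi> Wsp_diff[OF p] W0sp_Wsp[OF u] W0sp_Wsp[OF v])
qed

lemma gagliardo_tendsto_0:
  assumes "(\<lambda>n. Wsp_energy s p (f n)) \<longlonglongrightarrow> 0" "p > 0"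
  shows "(\<lambda>n. gagliardo s p (f n)) \<longlonglongrightarrow> 0"
proof -
  have "(\<lambda>n. gagliardo_energy s p (f n)) \<longlonglongrightarrow> 0"
    by (rule tendsto_sandwich[OF _ _ tendsto_const assms(1)]) (auto simp: Wsp_energy_def)
  then have "(\<lambda>n. enn2real (gagliardo_energy s p (f n))) \<longlonglongrightarrow> 0"
    using tendsto_enn2real[of _ 0] by simp
  from tendsto_powr'[OF this tendsto_const[of "1 / p"]] have "(\<lambda>n. gagliardo s p (f n)) \<longlonglongrightarrow> 0 powr (1 / p)"
    unfolding gagliardo_def using assms(2) by simp
  then show ?thesis by simp
qed

section \<open>The pairing: Hoelder bound, linearity in the second argument, diagonal values\<close>

lemma frac_p_pairing_eq:
  fixes u v :: "'a::euclidean_space \<Rightarrow> real"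
  shows "frac_p_pairing s p u v = (\<integral>z. \<bar>u (fst z) - u (snd z)\<bar> powr (p - 2) * (u (fst z) - u (snd z)) *
    (v (fst z) - v (snd z)) * gagliardo_kernel s p z \<partial>(lborel \<Otimes>\<^sub>M lborel))"
  by (simp add: frac_p_pairing_def gagliardo_kernel_def case_prod_unfold)

text \<open>Hoelder with weights \<open>1 - 1 / p\<close> and \<open>1 / p\<close>, the kernel being
  split between the two factors in the same proportion. Bounding the integral of the absolute value
  yields integrability and the estimate of the pairing together.\<close>

lemma nn_integral_pairing_le:
  fixes u v :: "'a::euclidean_space \<Rightarrow> real"
  assumes u: "u \<in> Wsp s p" and v: "v \<in> Wsp s p" and p: "1 < p"
  shows "(\<integral>\<^sup>+z. ennreal (norm (\<bar>u (fst z) - u (snd z)\<bar> powr (p - 2) * (u (fst z) - u (snd z)) *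
    (v (fst z) - v (snd z)) * gagliardo_kernel s p z)) \<partial>(lborel \<Otimes>\<^sub>M lborel))
    \<le> ennreal (gagliardo s p u powr (p - 1) * gagliardo s p v)"
proof -
  note [measurable] = Wsp_borel[OF u] Wsp_borel[OF v]
  define f where "f z = \<bar>u (fst z) - u (snd z)\<bar> powr p * gagliardo_kernel s p z" for z
  define g where "g z = \<bar>v (fst z) - v (snd z)\<bar> powr p * gagliardo_kernel s p z" for z
  have [measurable]: "f \<in> borel_measurable (lborel \<Otimes>\<^sub>M lborel)" "g \<in> borel_measurable (lborel \<Otimes>\<^sub>M lborel)"
    unfolding f_def[abs_def] g_def[abs_def] by measurable
  have pt: "norm (\<bar>u (fst z) - u (snd z)\<bar> powr (p - 2) * (u (fst z) - u (snd z)) *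
      (v (fst z) - v (snd z)) * gagliardo_kernel s p z) = f z powr (1 - 1 / p) * g z powr (1 - (1 - 1 / p))" for z
  proof -
    define k where "k = gagliardo_kernel s p z"
    define a where "a = u (fst z) - u (snd z)"
    define b where "b = v (fst z) - v (snd z)"
    have k: "k \<ge> 0" by (simp add: k_def)
    have "f z powr (1 - 1 / p) * g z powr (1 - (1 - 1 / p))
        = (\<bar>a\<bar> powr (p * (1 - 1 / p)) * \<bar>b\<bar> powr (p * (1 / p))) * (k powr (1 - 1 / p) * k powr (1 / p))"
      using k by (simp add: f_def g_def powr_mult powr_powr mult_ac flip: a_def b_def k_def)
    also have "\<dots> = \<bar>a\<bar> powr (p - 1) * \<bar>b\<bar> * k"
      using k p by (simp add: powr_add[symmetric] right_diff_distrib)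
    \<comment> \<open>The exponent \<open>p - 2\<close> may be negative; for \<open>a = 0\<close>
      the convention \<open>0 powr x = 0\<close> makes both sides vanish.\<close>
    also have "\<bar>a\<bar> powr (p - 1) = \<bar>a\<bar> powr (p - 2) * \<bar>a\<bar>"
    proof (cases "a = 0")
      case False
      then have "\<bar>a\<bar> powr (p - 2) * \<bar>a\<bar> powr 1 = \<bar>a\<bar> powr (p - 1)"
        by (simp only: powr_add[symmetric]) simp
      then show ?thesis by simp
    qed simp
    finally show ?thesis using k by (simp add: abs_mult flip: a_def b_def k_def)
  qed
  have "(\<integral>\<^sup>+z. ennreal (f z powr (1 - 1 / p) * g z powr (1 - (1 - 1 / p))) \<partial>(lborel \<Otimes>\<^sub>M lborel))
      \<le> ennreal ((gagliardo s p u powr p) powr (1 - 1 / p) * (gagliardo s p v powr p) powr (1 - (1 - 1 / p)))"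
  proof (rule nn_integral_Hoelder)
    show "(\<integral>\<^sup>+z. ennreal (f z) \<partial>(lborel \<Otimes>\<^sub>M lborel)) \<le> ennreal (gagliardo s p u powr p)"
      using p gagliardo_energy_powr[OF _ Wsp_gagliardo_finite[OF u]]
      unfolding f_def gagliardo_energy_eq[symmetric] by auto
    show "(\<integral>\<^sup>+z. ennreal (g z) \<partial>(lborel \<Otimes>\<^sub>M lborel)) \<le> ennreal (gagliardo s p v powr p)"
      using p gagliardo_energy_powr[OF _ Wsp_gagliardo_finite[OF v]]
      unfolding g_def gagliardo_energy_eq[symmetric] by auto
  qed (use p in \<open>auto simp: f_def g_def\<close>)
  also have "(gagliardo s p u powr p) powr (1 - 1 / p) * (gagliardo s p v powr p) powr (1 - (1 - 1 / p))
      = gagliardo s p u powr (p - 1) * gagliardo s p v"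
    using p by (simp add: powr_powr right_diff_distrib)
  finally show ?thesis unfolding pt .
qed

lemma integrable_pairing:
  fixes u v :: "'a::euclidean_space \<Rightarrow> real"
  assumes u: "u \<in> Wsp s p" and v: "v \<in> Wsp s p" and p: "1 < p"
  shows "integrable (lborel \<Otimes>\<^sub>M lborel) (\<lambda>z. \<bar>u (fst z) - u (snd z)\<bar> powr (p - 2) * (u (fst z) - u (snd z)) *
    (v (fst z) - v (snd z)) * gagliardo_kernel s p z)"
proof (rule integrableI_bounded)
  note [measurable] = Wsp_borel[OF u] Wsp_borel[OF v]
  show "(\<lambda>z. \<bar>u (fst z) - u (snd z)\<bar> powr (p - 2) * (u (fst z) - u (snd z)) *
    (v (fst z) - v (snd z)) * gagliardo_kernel s p z) \<in> borel_measurable (lborel \<Otimes>\<^sub>M lborel)"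
    by measurable
qed (rule order.strict_trans1[OF nn_integral_pairing_le[OF assms]], simp)

lemma abs_frac_p_pairing_le:
  assumes "u \<in> Wsp s p" "v \<in> Wsp s p" "1 < p"
  shows "\<bar>frac_p_pairing s p u v\<bar> \<le> gagliardo s p u powr (p - 1) * gagliardo s p v"
proof -
  have "ennreal (norm (frac_p_pairing s p u v)) \<le> ennreal (gagliardo s p u powr (p - 1) * gagliardo s p v)"
    unfolding frac_p_pairing_eq
    by (rule order.trans[OF integral_norm_bound_ennreal[OF integrable_pairing] nn_integral_pairing_le]) (fact assms)+
  then show ?thesis by (simp add: ennreal_le_iff)
qed

lemma frac_p_pairing_diff:
  assumes "u \<in> Wsp s p" "v \<in> Wsp s p" "w \<in> Wsp s p" "1 < p"
  shows "frac_p_pairing s p u (\<lambda>x. v x - w x) = frac_p_pairing s p u v - frac_p_pairing s p u w"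
  unfolding frac_p_pairing_eq
    Bochner_Integration.integral_diff[OF integrable_pairing[OF assms(1,2,4)] integrable_pairing[OF assms(1,3,4)], symmetric]
  by (intro Bochner_Integration.integral_cong refl) (simp add: algebra_simps)

lemma frac_p_pairing_self:
  fixes u :: "'a::euclidean_space \<Rightarrow> real"
  assumes "u \<in> Wsp s p" "1 < p"
  shows "frac_p_pairing s p u u = gagliardo s p u powr p"
proof -
  note [measurable] = Wsp_borel[OF assms(1)]
  have sq: "\<bar>a\<bar> powr (p - 2) * a * a = \<bar>a\<bar> powr p" for a :: real
  proof (cases "a = 0")
    case False
    have "\<bar>a\<bar> powr (p - 2) * \<bar>a\<bar> powr 2 = \<bar>a\<bar> powr p"
      by (simp only: powr_add[symmetric]) simp
    then show ?thesis using False by (simp add: powr_numeral power2_eq_square mult.assoc)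
  qed simp
  have "frac_p_pairing s p u u
      = (\<integral>z. \<bar>u (fst z) - u (snd z)\<bar> powr p * gagliardo_kernel s p z \<partial>(lborel \<Otimes>\<^sub>M lborel))"
    unfolding frac_p_pairing_eq sq ..
  also have "\<dots> = enn2real (gagliardo_energy s p u)"
    unfolding gagliardo_energy_eq by (rule integral_eq_nn_integral) auto
  finally show ?thesis using assms(2) by (simp add: gagliardo_powr)
qed

section \<open>Energy estimates for the singular problem\<close>

text \<open>The weight lives on the whole space, is nonnegative at every point and vanishes off
  \<Omega>, so all integrals run over \<open>lborel\<close> without exceptional sets for its sign.
  The lower bounds are stated for compact sets because the support of a test function need not be
  connected.\<close>

locale singular_solution =
  fixes \<Omega> :: "'a::euclidean_space set" and w u :: "'a \<Rightarrow> real" and s p \<alpha> :: real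
  assumes p: "1 < p" and \<alpha>: "0 < \<alpha>" "\<alpha> < 1"
    and w_borel [measurable]: "w \<in> borel_measurable borel"
    and w_nonneg: "\<And>x. 0 \<le> w x" and w_outside: "\<And>x. x \<notin> \<Omega> \<Longrightarrow> w x = 0"
    and w_integrable: "integrable lborel w"
    and u_W0sp: "u \<in> W0sp s p \<Omega>"
    and u_lower: "\<And>K. compact K \<Longrightarrow> K \<subseteq> \<Omega> \<Longrightarrow> \<exists>c>0. AE x in lborel. x \<in> K \<longrightarrow> c \<le> u x"
    and u_pos: "AE x in lborel. x \<in> \<Omega> \<longrightarrow> 0 < u x"
    and u_eq: "\<And>\<phi>. \<phi> \<in> Cc_inf \<Omega> \<Longrightarrow> frac_p_pairing s p u \<phi> = (\<integral>x. w x * \<phi> x / u x powr \<alpha> \<partial>lborel)"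
begin

lemma u_Wsp: "u \<in> Wsp s p"
  using u_W0sp by (rule W0sp_Wsp)

lemma u_borel [measurable]: "u \<in> borel_measurable borel"
  using u_Wsp by (rule Wsp_borel)

text \<open>On the compact support of \<phi> the function u is bounded below by a positive constant,
  so the integrand is dominated by a multiple of the integrable weight.\<close>

lemma integrable_test:
  assumes \<phi>: "\<phi> \<in> Cc_inf \<Omega>"
  shows "integrable lborel (\<lambda>x. w x * \<phi> x / u x powr \<alpha>)"
proof -
  note [measurable] = Cc_inf_borel[OF \<phi>]
  define K where "K = closure {x. \<phi> x \<noteq> 0}"
  have K: "compact K" "K \<subseteq> \<Omega>" using \<phi> unfolding Cc_inf_def K_def by blast+
  have "compact (\<phi> ` K)"
    using continuous_on_subset[OF Cc_inf_continuous[OF \<phi>]] K by (intro compact_continuous_image) auto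
  then obtain B where B: "\<And>x. x \<in> K \<Longrightarrow> \<bar>\<phi> x\<bar> \<le> B"
    using compact_imp_bounded by (force simp: bounded_iff)
  obtain c where c: "c > 0" "AE x in lborel. x \<in> K \<longrightarrow> c \<le> u x"
    using u_lower[OF K] by blast
  show ?thesis
  proof (rule Bochner_Integration.integrable_bound)
    show "integrable lborel (\<lambda>x. w x * (\<bar>B\<bar> / c powr \<alpha>))"
      using w_integrable by simp
    show "AE x in lborel. norm (w x * \<phi> x / u x powr \<alpha>) \<le> norm (w x * (\<bar>B\<bar> / c powr \<alpha>))"
      using c(2)
    proof eventually_elim
      case (elim x)
      show ?case
      proof (cases "x \<in> K")
        case True
        then have "\<bar>\<phi> x\<bar> / u x powr \<alpha> \<le> \<bar>B\<bar> / c powr \<alpha>"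
          using elim c(1) B[OF True] \<alpha> by (intro frac_le powr_mono2) auto
        then have "w x * (\<bar>\<phi> x\<bar> / u x powr \<alpha>) \<le> w x * (\<bar>B\<bar> / c powr \<alpha>)"
          using w_nonneg by (rule mult_left_mono)
        then show ?thesis using w_nonneg[of x] by (simp add: abs_mult)
      next
        case False
        then have "\<phi> x = 0" using closure_subset[of "{x. \<phi> x \<noteq> 0}"] by (auto simp: K_def)
        then show ?thesis by simp
      qed
    qed
  qed measurable
qed

text \<open>For nonnegative \<phi> the singular term is an integral without cancellation, so the
  equation identifies its absolute version with the pairing, which Hoelder bounds.\<close>

lemma weighted_bound_nonneg_test:
  assumes \<phi>: "\<phi> \<in> Cc_inf \<Omega>" and fin: "\<phi> \<in> Wsp s p" and nonneg: "\<And>x. 0 \<le> \<phi> x"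
  shows "(\<integral>\<^sup>+x. ennreal (w x * \<bar>\<phi> x\<bar> / u x powr \<alpha>) \<partial>lborel)
    \<le> ennreal (gagliardo s p u powr (p - 1) * gagliardo s p \<phi>)"
proof -
  have "(\<integral>\<^sup>+x. ennreal (w x * \<bar>\<phi> x\<bar> / u x powr \<alpha>) \<partial>lborel) = ennreal (frac_p_pairing s p u \<phi>)"
    unfolding u_eq[OF \<phi>] using integrable_test[OF \<phi>] nonneg w_nonneg
    by (subst nn_integral_eq_integral[symmetric]) auto
  also have "\<dots> \<le> ennreal (gagliardo s p u powr (p - 1) * gagliardo s p \<phi>)"
    using abs_frac_p_pairing_le[OF u_Wsp fin p] by (intro ennreal_leI) linarith
  finally show ?thesis .
qed

text \<open>The absolute value of a test function is not smooth, so it is approximated from below by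
  \<open>smooth_abs\<close>, which does not increase the seminorm.\<close>

lemma weighted_bound_test:
  assumes \<phi>: "\<phi> \<in> Cc_inf \<Omega>" and fin: "\<phi> \<in> Wsp s p"
  shows "(\<integral>\<^sup>+x. ennreal (w x * \<bar>\<phi> x\<bar> / u x powr \<alpha>) \<partial>lborel)
    \<le> ennreal (gagliardo s p u powr (p - 1) * gagliardo s p \<phi>)"
proof -
  note [measurable] = Cc_inf_borel[OF \<phi>]
  define \<psi> where "\<psi> n x = smooth_abs (inverse (real (Suc n))) (\<phi> x)" for n x
  have \<psi>: "\<psi> n \<in> Cc_inf \<Omega>" for n
    unfolding \<psi>_def[abs_def] by (rule Cc_inf_smooth_abs[OF \<phi>]) simp
  note [measurable] = Cc_inf_borel[OF \<psi>]
  have diff: "\<bar>\<psi> n x - \<psi> n y\<bar> \<le> \<bar>\<phi> x - \<phi> y\<bar>" for n x y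
    unfolding \<psi>_def by (rule smooth_abs_lipschitz)
  \<comment> \<open>The Lipschitz estimate is compared with the point 0, where
    \<open>smooth_abs\<close> vanishes. With \<open>diff\<close> it bounds both parts of the energy
    of \<open>\<psi> n\<close> by those of \<phi>.\<close>
  have abs: "\<bar>\<psi> n x\<bar> \<le> \<bar>\<phi> x\<bar>" for n x
    using smooth_abs_lipschitz[of "inverse (real (Suc n))" "\<phi> x" 0] smooth_abs_eq_0_iff[of "inverse (real (Suc n))" 0]
    by (simp add: \<psi>_def)
  have "Wsp_energy s p (\<psi> n) \<le> Wsp_energy s p \<phi>" for n
    unfolding Wsp_energy_def using p abs diff
    by (intro add_mono gagliardo_energy_mono nn_integral_mono ennreal_leI powr_mono2) auto
  then have \<psi>W: "\<psi> n \<in> Wsp s p" for n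
    using fin Cc_inf_borel[OF \<psi>[of n]] by (auto simp: Wsp_iff intro: order.strict_trans1)
  have bound: "(\<integral>\<^sup>+x. ennreal (w x * \<bar>\<psi> n x\<bar> / u x powr \<alpha>) \<partial>lborel)
      \<le> ennreal (gagliardo s p u powr (p - 1) * gagliardo s p \<phi>)" for n
  proof -
    have "gagliardo s p (\<psi> n) \<le> gagliardo s p \<phi>"
      using p by (intro gagliardo_mono diff Wsp_gagliardo_finite[OF fin]) auto
    then have "ennreal (gagliardo s p u powr (p - 1) * gagliardo s p (\<psi> n))
        \<le> ennreal (gagliardo s p u powr (p - 1) * gagliardo s p \<phi>)"
      by (intro ennreal_leI mult_left_mono) auto
    moreover have "0 \<le> \<psi> n x" for x by (simp add: \<psi>_def smooth_abs_nonneg)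
    ultimately show ?thesis
      using weighted_bound_nonneg_test[OF \<psi> \<psi>W] by (meson order.trans)
  qed
  have lim: "(\<lambda>n. ennreal (w x * \<bar>\<psi> n x\<bar> / u x powr \<alpha>)) \<longlonglongrightarrow> ennreal (w x * \<bar>\<phi> x\<bar> / u x powr \<alpha>)" for x
  proof -
    have "(\<lambda>n. \<psi> n x) \<longlonglongrightarrow> \<bar>\<phi> x\<bar>"
      unfolding \<psi>_def by (intro smooth_abs_tendsto LIMSEQ_inverse_real_of_nat)
    from tendsto_rabs[OF this] have "(\<lambda>n. \<bar>\<psi> n x\<bar>) \<longlonglongrightarrow> \<bar>\<phi> x\<bar>" by simp
    then have "(\<lambda>n. w x * \<bar>\<psi> n x\<bar> * inverse (u x powr \<alpha>)) \<longlonglongrightarrow> w x * \<bar>\<phi> x\<bar> * inverse (u x powr \<alpha>)"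
      by (intro tendsto_mult tendsto_const)
    then show ?thesis unfolding divide_inverse by (rule tendsto_ennrealI)
  qed
  have "(\<integral>\<^sup>+x. ennreal (w x * \<bar>\<phi> x\<bar> / u x powr \<alpha>) \<partial>lborel)
      = (\<integral>\<^sup>+x. liminf (\<lambda>n. ennreal (w x * \<bar>\<psi> n x\<bar> / u x powr \<alpha>)) \<partial>lborel)"
    by (intro nn_integral_cong) (use lim_imp_Liminf[OF _ lim] in simp)
  also have "\<dots> \<le> liminf (\<lambda>n. \<integral>\<^sup>+x. ennreal (w x * \<bar>\<psi> n x\<bar> / u x powr \<alpha>) \<partial>lborel)"
    by (intro nn_integral_liminf) measurable
  also have "\<dots> \<le> limsup (\<lambda>n. \<integral>\<^sup>+x. ennreal (w x * \<bar>\<psi> n x\<bar> / u x powr \<alpha>) \<partial>lborel)"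
    by (rule Liminf_le_Limsup) simp
  also have "\<dots> \<le> ennreal (gagliardo s p u powr (p - 1) * gagliardo s p \<phi>)"
    by (intro Limsup_bounded always_eventually allI bound)
  finally show ?thesis .
qed

text \<open>Both parts of the \<open>Wsp\<close> energy are used: the p-th mean gives almost
  everywhere convergence of a subsequence, as Fatou's lemma requires, and the seminorm part controls
  the right-hand sides.\<close>

lemma weighted_bound:
  assumes v: "v \<in> W0sp s p \<Omega>"
  shows "(\<integral>\<^sup>+x. ennreal (w x * \<bar>v x\<bar> / u x powr \<alpha>) \<partial>lborel)
    \<le> ennreal (gagliardo s p u powr (p - 1) * gagliardo s p v)"
proof -
  have p1: "1 \<le> p" "0 < p" using p by auto
  obtain \<phi> where \<phi>: "\<And>n. \<phi> n \<in> Cc_inf \<Omega>" "\<And>n. \<phi> n \<in> Wsp s p"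
    "(\<lambda>n. Wsp_energy s p (\<lambda>x. \<phi> n x - v x)) \<longlonglongrightarrow> 0"
    using W0spE[OF v p1(1)] by blast
  have vW: "v \<in> Wsp s p" using v by (rule W0sp_Wsp)
  note [measurable] = Wsp_borel[OF vW] Wsp_borel[OF \<phi>(2)]
  have dW: "(\<lambda>x. \<phi> n x - v x) \<in> Wsp s p" for n
    by (rule Wsp_diff[OF p1(1) \<phi>(2) vW])
  have "(\<lambda>n. \<integral>\<^sup>+x. ennreal (\<bar>\<phi> n x - v x\<bar> powr p) \<partial>lborel) \<longlonglongrightarrow> 0"
    by (rule tendsto_sandwich[OF _ _ tendsto_const \<phi>(3)]) (auto simp: Wsp_energy_def)
  moreover have "(\<integral>\<^sup>+x. ennreal (\<bar>\<phi> n x - v x\<bar> powr p) \<partial>lborel) < \<infinity>" for n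
    using dW[of n] by (simp add: Wsp_def in_Lp_def)
  ultimately obtain r :: "nat \<Rightarrow> nat" where r: "strict_mono r" "AE x in lborel. (\<lambda>n. \<phi> (r n) x - v x) \<longlonglongrightarrow> 0"
    using p1 by (elim tendsto_AE_subseq_powr[rotated 2]) auto
  have gd: "(\<lambda>n. gagliardo s p (\<lambda>x. \<phi> (r n) x - v x)) \<longlonglongrightarrow> 0"
    using LIMSEQ_subseq_LIMSEQ[OF gagliardo_tendsto_0[OF \<phi>(3) p1(2)] r(1)] by (simp add: o_def)
  define G where "G = gagliardo s p u powr (p - 1)"
  have bound: "(\<integral>\<^sup>+x. ennreal (w x * \<bar>\<phi> (r n) x\<bar> / u x powr \<alpha>) \<partial>lborel)
      \<le> ennreal (G * (gagliardo s p (\<lambda>x. \<phi> (r n) x - v x) + gagliardo s p v))" for n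
  proof -
    \<comment> \<open>The triangle inequality replaces the seminorm of the approximant by an upper
      bound whose limit is known.\<close>
    have "gagliardo s p (\<lambda>x. (\<phi> (r n) x - v x) + v x) \<le> gagliardo s p (\<lambda>x. \<phi> (r n) x - v x) + gagliardo s p v"
      using p1 Wsp_gagliardo_finite[OF dW] Wsp_gagliardo_finite[OF vW] by (intro gagliardo_triangle) auto
    then have "ennreal (G * gagliardo s p (\<phi> (r n)))
        \<le> ennreal (G * (gagliardo s p (\<lambda>x. \<phi> (r n) x - v x) + gagliardo s p v))"
      by (intro ennreal_leI mult_left_mono) (auto simp: G_def)
    then show ?thesis
      using weighted_bound_test[OF \<phi>(1,2), of "r n"] unfolding G_def by (rule order.trans[rotated])
  qed
  have "AE x in lborel. (\<lambda>n. ennreal (w x * \<bar>\<phi> (r n) x\<bar> / u x powr \<alpha>)) \<longlonglongrightarrow> ennreal (w x * \<bar>v x\<bar> / u x powr \<alpha>)"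
    using r(2)
  proof eventually_elim
    case (elim x)
    have "(\<lambda>n. \<bar>\<phi> (r n) x\<bar>) \<longlonglongrightarrow> \<bar>v x\<bar>"
      by (rule tendsto_rabs[OF LIM_zero_cancel[OF elim]])
    then have "(\<lambda>n. w x * \<bar>\<phi> (r n) x\<bar> * inverse (u x powr \<alpha>)) \<longlonglongrightarrow> w x * \<bar>v x\<bar> * inverse (u x powr \<alpha>)"
      by (intro tendsto_mult tendsto_const)
    then show ?case unfolding divide_inverse by (rule tendsto_ennrealI)
  qed
  then have "(\<integral>\<^sup>+x. ennreal (w x * \<bar>v x\<bar> / u x powr \<alpha>) \<partial>lborel)
      = (\<integral>\<^sup>+x. liminf (\<lambda>n. ennreal (w x * \<bar>\<phi> (r n) x\<bar> / u x powr \<alpha>)) \<partial>lborel)"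
    by (intro nn_integral_cong_AE) (auto elim!: eventually_mono simp: lim_imp_Liminf)
  also have "\<dots> \<le> liminf (\<lambda>n. \<integral>\<^sup>+x. ennreal (w x * \<bar>\<phi> (r n) x\<bar> / u x powr \<alpha>) \<partial>lborel)"
    by (intro nn_integral_liminf) measurable
  also have "\<dots> \<le> liminf (\<lambda>n. ennreal (G * (gagliardo s p (\<lambda>x. \<phi> (r n) x - v x) + gagliardo s p v)))"
    by (intro Liminf_mono always_eventually allI bound)
  also have "\<dots> = ennreal (G * (0 + gagliardo s p v))"
    by (intro lim_imp_Liminf tendsto_ennrealI tendsto_mult tendsto_add tendsto_const gd) simp
  finally show ?thesis by (simp add: G_def)
qed

lemma integrable_weighted:
  assumes v: "v \<in> W0sp s p \<Omega>"
  shows "integrable lborel (\<lambda>x. w x * v x / u x powr \<alpha>)"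
proof (rule integrableI_bounded)
  note [measurable] = Wsp_borel[OF W0sp_Wsp[OF v]]
  show "(\<lambda>x. w x * v x / u x powr \<alpha>) \<in> borel_measurable lborel" by measurable
  have "(\<integral>\<^sup>+x. ennreal (norm (w x * v x / u x powr \<alpha>)) \<partial>lborel) = (\<integral>\<^sup>+x. ennreal (w x * \<bar>v x\<bar> / u x powr \<alpha>) \<partial>lborel)"
    using w_nonneg by (simp add: abs_mult)
  also have "\<dots> < \<infinity>" by (rule order.strict_trans1[OF weighted_bound[OF v]]) simp
  finally show "(\<integral>\<^sup>+x. ennreal (norm (w x * v x / u x powr \<alpha>)) \<partial>lborel) < \<infinity>" .
qed

text \<open>Continuity of the singular term as a linear functional on \<open>W0sp\<close>, the
  property that lets u be used as a test function.\<close>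

lemma abs_weighted_le:
  assumes v: "v \<in> W0sp s p \<Omega>"
  shows "\<bar>\<integral>x. w x * v x / u x powr \<alpha> \<partial>lborel\<bar> \<le> gagliardo s p u powr (p - 1) * gagliardo s p v"
proof -
  have "ennreal (norm (\<integral>x. w x * v x / u x powr \<alpha> \<partial>lborel)) \<le> (\<integral>\<^sup>+x. ennreal (norm (w x * v x / u x powr \<alpha>)) \<partial>lborel)"
    by (rule integral_norm_bound_ennreal[OF integrable_weighted[OF v]])
  also have "\<dots> = (\<integral>\<^sup>+x. ennreal (w x * \<bar>v x\<bar> / u x powr \<alpha>) \<partial>lborel)"
    using w_nonneg by (simp add: abs_mult)
  also note weighted_bound[OF v]
  finally show ?thesis by (simp add: ennreal_le_iff)
qed

text \<open>The pairing with u and the singular term agree on test functions and are both bounded by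
  the seminorm, hence they agree at the limit u of test functions.\<close>

lemma energy_identity: "(\<integral>x. w x * u x / u x powr \<alpha> \<partial>lborel) = gagliardo s p u powr p"
proof -
  have p1: "1 \<le> p" "0 < p" using p by auto
  obtain \<phi> where \<phi>: "\<And>n. \<phi> n \<in> Cc_inf \<Omega>" "\<And>n. \<phi> n \<in> Wsp s p"
    "(\<lambda>n. Wsp_energy s p (\<lambda>x. \<phi> n x - u x)) \<longlonglongrightarrow> 0"
    using W0spE[OF u_W0sp p1(1)] by blast
  define G where "G = gagliardo s p u powr (p - 1)"
  define I where "I = (\<integral>x. w x * u x / u x powr \<alpha> \<partial>lborel)"
  \<comment> \<open>The factor 2 collects one error for each of the two functionals evaluated at
    \<open>\<phi> n - u\<close>.\<close>
  have le: "\<bar>I - gagliardo s p u powr p\<bar> \<le> 2 * (G * gagliardo s p (\<lambda>x. \<phi> n x - u x))" for n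
  proof -
    have \<phi>0: "\<phi> n \<in> W0sp s p \<Omega>" using \<phi>(1,2) by (rule Cc_inf_in_W0sp)
    have d: "(\<lambda>x. \<phi> n x - u x) \<in> W0sp s p \<Omega>" by (rule W0sp_diff[OF \<phi>0 u_W0sp p1(1)])
    have "(\<integral>x. w x * (\<phi> n x - u x) / u x powr \<alpha> \<partial>lborel) = (\<integral>x. w x * \<phi> n x / u x powr \<alpha> \<partial>lborel) - I"
      unfolding I_def
      by (subst Bochner_Integration.integral_diff[symmetric])
         (auto intro!: integrable_weighted \<phi>0 u_W0sp Bochner_Integration.integral_cong
           simp: right_diff_distrib diff_divide_distrib)
    also have "(\<integral>x. w x * \<phi> n x / u x powr \<alpha> \<partial>lborel) = frac_p_pairing s p u (\<phi> n)"
      using u_eq[OF \<phi>(1)] by simp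
    finally have "(\<integral>x. w x * (\<phi> n x - u x) / u x powr \<alpha> \<partial>lborel) = frac_p_pairing s p u (\<phi> n) - I" .
    moreover have "frac_p_pairing s p u (\<lambda>x. \<phi> n x - u x) = frac_p_pairing s p u (\<phi> n) - gagliardo s p u powr p"
      using frac_p_pairing_diff[OF u_Wsp \<phi>(2) u_Wsp p] frac_p_pairing_self[OF u_Wsp p] by simp
    ultimately show ?thesis
      using abs_weighted_le[OF d] abs_frac_p_pairing_le[OF u_Wsp W0sp_Wsp[OF d] p] unfolding G_def by linarith
  qed
  have "(\<lambda>n. 2 * (G * gagliardo s p (\<lambda>x. \<phi> n x - u x))) \<longlonglongrightarrow> 2 * (G * 0)"
    by (intro tendsto_mult tendsto_const gagliardo_tendsto_0[OF \<phi>(3) p1(2)])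
  then have "\<bar>I - gagliardo s p u powr p\<bar> \<le> 2 * (G * 0)"
    by (rule LIMSEQ_le_const) (use le in blast)
  then show ?thesis by (simp add: I_def)
qed

lemma energy_identity_nn:
  "(\<integral>\<^sup>+x. ennreal (w x * \<bar>u x\<bar> powr (1 - \<alpha>)) \<partial>lborel) = ennreal (gagliardo s p u powr p)"
proof -
  \<comment> \<open>The powers combine only where u is positive, which holds almost everywhere in
    \<Omega>; elsewhere the weight is zero.\<close>
  have "AE x in lborel. w x * u x / u x powr \<alpha> = w x * \<bar>u x\<bar> powr (1 - \<alpha>)"
    using u_pos
  proof eventually_elim
    case (elim x)
    then show ?case using w_outside[of x] by (cases "x \<in> \<Omega>") (simp_all add: powr_diff)
  qed
  then have "(\<integral>\<^sup>+x. ennreal (w x * \<bar>u x\<bar> powr (1 - \<alpha>)) \<partial>lborel) = (\<integral>\<^sup>+x. ennreal (w x * u x / u x powr \<alpha>) \<partial>lborel)"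
    by (intro nn_integral_cong_AE) (auto elim!: eventually_mono)
  also have "\<dots> = ennreal (\<integral>x. w x * u x / u x powr \<alpha> \<partial>lborel)"
  proof (rule nn_integral_eq_integral[OF integrable_weighted[OF u_W0sp]])
    show "AE x in lborel. 0 \<le> w x * u x / u x powr \<alpha>"
      using u_pos
    proof eventually_elim
      case (elim x)
      then show ?case using w_outside[of x] w_nonneg[of x] by (cases "x \<in> \<Omega>") auto
    qed
  qed
  finally show ?thesis by (simp add: energy_identity)
qed

text \<open>Hoelder's inequality with exponents \<open>1 / (1 - \<alpha>)\<close> and \<open>1 / \<alpha>\<close> for
  \<open>\<bar>v\<bar>\<^sup>1\<^sup>-\<^sup>\<alpha> = (\<bar>v\<bar> u\<^sup>-\<^sup>\<alpha>)\<^sup>1\<^sup>-\<^sup>\<alpha> (u\<^sup>1\<^sup>-\<^sup>\<alpha>)\<^sup>\<alpha>\<close>.\<close>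

lemma weighted_power_bound:
  assumes v: "v \<in> W0sp s p \<Omega>"
  shows "(\<integral>\<^sup>+x. ennreal (w x * \<bar>v x\<bar> powr (1 - \<alpha>)) \<partial>lborel)
    \<le> ennreal ((gagliardo s p u powr (p - 1) * gagliardo s p v) powr (1 - \<alpha>) * (gagliardo s p u powr p) powr \<alpha>)"
proof -
  note [measurable] = Wsp_borel[OF W0sp_Wsp[OF v]]
  define f where "f x = w x * \<bar>v x\<bar> / u x powr \<alpha>" for x
  define g where "g x = w x * \<bar>u x\<bar> powr (1 - \<alpha>)" for x
  have [measurable]: "f \<in> borel_measurable lborel" "g \<in> borel_measurable lborel"
    unfolding f_def[abs_def] g_def[abs_def] by measurable
  have "AE x in lborel. w x * \<bar>v x\<bar> powr (1 - \<alpha>) = f x powr (1 - \<alpha>) * g x powr (1 - (1 - \<alpha>))"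
    using u_pos
  proof eventually_elim
    case (elim x)
    show ?case
    proof (cases "x \<in> \<Omega>")
      case True
      with elim have u: "u x > 0" by simp
      have "f x powr (1 - \<alpha>) * g x powr (1 - (1 - \<alpha>))
          = (w x powr (1 - \<alpha>) * w x powr \<alpha>) * \<bar>v x\<bar> powr (1 - \<alpha>) * (u x powr ((1 - \<alpha>) * \<alpha>) / u x powr (\<alpha> * (1 - \<alpha>)))"
        using u w_nonneg[of x] by (simp add: f_def g_def powr_mult powr_divide powr_powr mult_ac)
      also have "w x powr (1 - \<alpha>) * w x powr \<alpha> = w x"
        using w_nonneg[of x] by (simp add: powr_add[symmetric])
      also have "u x powr ((1 - \<alpha>) * \<alpha>) / u x powr (\<alpha> * (1 - \<alpha>)) = 1"
        using u by (simp add: mult.commute)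
      finally show ?thesis by simp
    qed (simp add: w_outside f_def)
  qed
  then have "(\<integral>\<^sup>+x. ennreal (w x * \<bar>v x\<bar> powr (1 - \<alpha>)) \<partial>lborel)
      = (\<integral>\<^sup>+x. ennreal (f x powr (1 - \<alpha>) * g x powr (1 - (1 - \<alpha>))) \<partial>lborel)"
    by (intro nn_integral_cong_AE) (auto elim!: eventually_mono)
  also have "\<dots> \<le> ennreal ((gagliardo s p u powr (p - 1) * gagliardo s p v) powr (1 - \<alpha>)
      * (gagliardo s p u powr p) powr (1 - (1 - \<alpha>)))"
    using weighted_bound[OF v] energy_identity_nn \<alpha> w_nonneg
    by (intro nn_integral_Hoelder) (auto simp: f_def g_def)
  finally show ?thesis by simp
qed

lemma weighted_Sobolev:
  assumes v: "v \<in> W0sp s p \<Omega>" and pos: "0 < gagliardo s p u"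
  shows "gagliardo s p u powr (p * ((1 - \<alpha> - p) / (1 - \<alpha>))) *
    enn2real (\<integral>\<^sup>+x. ennreal (w x * \<bar>v x\<bar> powr (1 - \<alpha>)) \<partial>lborel) powr (p / (1 - \<alpha>)) \<le> gagliardo s p v powr p"
proof -
  define A B where "A = gagliardo s p u" and "B = gagliardo s p v"
  have AB: "A > 0" "B \<ge> 0" using pos by (simp_all add: A_def B_def)
  have "enn2real (\<integral>\<^sup>+x. ennreal (w x * \<bar>v x\<bar> powr (1 - \<alpha>)) \<partial>lborel)
      \<le> (A powr (p - 1) * B) powr (1 - \<alpha>) * (A powr p) powr \<alpha>"
    using weighted_power_bound[OF v] by (intro enn2real_leI) (simp_all add: A_def B_def)
  then have "enn2real (\<integral>\<^sup>+x. ennreal (w x * \<bar>v x\<bar> powr (1 - \<alpha>)) \<partial>lborel) powr (p / (1 - \<alpha>))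
      \<le> ((A powr (p - 1) * B) powr (1 - \<alpha>) * (A powr p) powr \<alpha>) powr (p / (1 - \<alpha>))"
    using p \<alpha> by (intro powr_mono2) auto
  also have "\<dots> = A powr ((p - 1) * p + p * \<alpha> * (p / (1 - \<alpha>))) * B powr p"
    using AB p \<alpha> by (simp add: powr_mult powr_powr powr_add)
  finally have "A powr (p * ((1 - \<alpha> - p) / (1 - \<alpha>))) *
      enn2real (\<integral>\<^sup>+x. ennreal (w x * \<bar>v x\<bar> powr (1 - \<alpha>)) \<partial>lborel) powr (p / (1 - \<alpha>))
      \<le> A powr (p * ((1 - \<alpha> - p) / (1 - \<alpha>))) * (A powr ((p - 1) * p + p * \<alpha> * (p / (1 - \<alpha>))) * B powr p)"
    by (intro mult_left_mono) auto
  also have "\<dots> = A powr (p * ((1 - \<alpha> - p) / (1 - \<alpha>)) + ((p - 1) * p + p * \<alpha> * (p / (1 - \<alpha>)))) * B powr p"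
    by (simp only: powr_add mult.assoc)
  \<comment> \<open>The bracket equals \<open>p * (p - 1 + \<alpha>) / (1 - \<alpha>)\<close>, so
    the powers of A cancel. Then \<open>A powr 0 = 1\<close> uses that A is not zero.\<close>
  also have "p * ((1 - \<alpha> - p) / (1 - \<alpha>)) + ((p - 1) * p + p * \<alpha> * (p / (1 - \<alpha>))) = 0"
    using \<alpha> by (simp add: field_simps)
  finally show ?thesis using AB by (simp add: A_def B_def)
qed

lemma weighted_Sobolev_extremal:
  assumes pos: "0 < gagliardo s p u"
  obtains v where "v \<in> W0sp s p \<Omega>"
    "enn2real (\<integral>\<^sup>+x. ennreal (w x * \<bar>v x\<bar> powr (1 - \<alpha>)) \<partial>lborel) = 1"
    "gagliardo s p v powr p = gagliardo s p u powr (p * ((1 - \<alpha> - p) / (1 - \<alpha>)))"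
proof -
  define A where "A = gagliardo s p u"
  \<comment> \<open>Chosen so that \<open>c powr (1 - \<alpha>) * A powr p = 1\<close>: by the
    energy identity this normalizes the weighted integral of \<open>c * u\<close>.\<close>
  define c where "c = A powr (- p / (1 - \<alpha>))"
  have A: "A > 0" and c: "c > 0" using pos by (simp_all add: A_def c_def)
  have "(\<integral>\<^sup>+x. ennreal (w x * \<bar>c * u x\<bar> powr (1 - \<alpha>)) \<partial>lborel)
      = ennreal (c powr (1 - \<alpha>)) * (\<integral>\<^sup>+x. ennreal (w x * \<bar>u x\<bar> powr (1 - \<alpha>)) \<partial>lborel)"
    using c w_nonneg
    by (subst nn_integral_cmult[symmetric]) (auto simp: abs_mult powr_mult ennreal_mult[symmetric] mult_ac)
  also have "\<dots> = ennreal (c powr (1 - \<alpha>) * A powr p)"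
    by (simp add: energy_identity_nn A_def ennreal_mult)
  also have "c powr (1 - \<alpha>) * A powr p = 1"
    using A \<alpha> by (simp add: c_def powr_powr powr_add[symmetric])
  finally have 1: "enn2real (\<integral>\<^sup>+x. ennreal (w x * \<bar>c * u x\<bar> powr (1 - \<alpha>)) \<partial>lborel) = 1" by simp
  have "gagliardo s p (\<lambda>x. c * u x) powr p = A powr ((- p / (1 - \<alpha>)) * p + p)"
    using p c A by (simp only: powr_add) (simp add: gagliardo_cmult powr_mult powr_powr c_def flip: A_def)
  also have "(- p / (1 - \<alpha>)) * p + p = p * ((1 - \<alpha> - p) / (1 - \<alpha>))"
    using \<alpha> by (simp add: field_simps)
  finally show ?thesis using that[of "\<lambda>x. c * u x"] 1 W0sp_cmult[OF u_W0sp] by (simp add: A_def)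
qed

end

section \<open>Positivity of weak solutions\<close>

text \<open>The definition speaks of connected subdomains only. A compact set is covered by finitely
  many balls with closure in \<Omega>, each of them admissible, and the least of their constants
  works.\<close>

lemma weak_solution_lower_bound:
  fixes \<Omega> :: "'a::euclidean_space set"
  assumes u: "weak_solution s p \<Omega> \<alpha> \<omega> u" and "open \<Omega>" and K: "compact K" "K \<subseteq> \<Omega>"
  shows "\<exists>c>0. AE x in lborel. x \<in> K \<longrightarrow> c \<le> u x"
proof -
  have "\<exists>e>0. cball x e \<subseteq> \<Omega>" if "x \<in> K" for x
    using that K \<open>open \<Omega>\<close> open_contains_cball by blast
  then obtain e where e: "\<And>x. x \<in> K \<Longrightarrow> e x > 0" "\<And>x. x \<in> K \<Longrightarrow> cball x (e x) \<subseteq> \<Omega>" by metis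
  have "K \<subseteq> (\<Union>x\<in>K. ball x (e x))" using e(1) by force
  from compactE_image[OF K(1) _ this] obtain F where F: "F \<subseteq> K" "finite F" "K \<subseteq> (\<Union>x\<in>F. ball x (e x))"
    by auto
  have "\<exists>c>0. AE x in lborel. x \<in> (\<Union>y\<in>F. ball y (e y)) \<longrightarrow> c \<le> u x"
    using F(2,1)
  proof (induction F rule: finite_induct)
    case empty
    show ?case by (auto intro: exI[of _ 1])
  next
    case (insert y F)
    then obtain c where c: "c > 0" "AE x in lborel. x \<in> (\<Union>y\<in>F. ball y (e y)) \<longrightarrow> c \<le> u x" by auto
    have "open (ball y (e y)) \<and> connected (ball y (e y)) \<and> compact (closure (ball y (e y))) \<and> closure (ball y (e y)) \<subseteq> \<Omega>"
      using insert.prems e[of y] by simp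
    then obtain d where d: "d > 0" "AE x in lborel. x \<in> ball y (e y) \<longrightarrow> d \<le> u x"
      using u unfolding weak_solution_def by blast
    have "AE x in lborel. x \<in> (\<Union>y\<in>insert y F. ball y (e y)) \<longrightarrow> min c d \<le> u x"
      using c(2) d(2) by eventually_elim auto
    then show ?case using c(1) d(1) by (intro exI[of _ "min c d"]) auto
  qed
  then obtain c where c: "c > 0" "AE x in lborel. x \<in> (\<Union>y\<in>F. ball y (e y)) \<longrightarrow> c \<le> u x" by blast
  from c(2) have "AE x in lborel. x \<in> K \<longrightarrow> c \<le> u x" by eventually_elim (use F(3) in blast)
  with c(1) show ?thesis by blast
qed

text \<open>An open set is a countable union of compact sets, so the exceptional null sets of the
  local bounds add up to a null set.\<close>

lemma weak_solution_pos:
  fixes \<Omega> :: "'a::euclidean_space set"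
  assumes u: "weak_solution s p \<Omega> \<alpha> \<omega> u" and "open \<Omega>"
  shows "AE x in lborel. x \<in> \<Omega> \<longrightarrow> 0 < u x"
proof -
  obtain C :: "nat \<Rightarrow> 'a set" where C: "\<And>n. compact (C n)" "\<And>n. C n \<subseteq> \<Omega>" "\<Union> (range C) = \<Omega>"
    using open_Union_compact_subsets[OF \<open>open \<Omega>\<close>] by metis
  have "AE x in lborel. x \<in> C n \<longrightarrow> 0 < u x" for n
    using weak_solution_lower_bound[OF assms C(1,2)] by (force elim!: eventually_mono)
  then have "AE x in lborel. \<forall>n. x \<in> C n \<longrightarrow> 0 < u x" unfolding AE_all_countable ..
  then show ?thesis by eventually_elim (use C(3) in blast)
qed

section \<open>Integrability of the weight\<close>

lemma hoelder_conj_ge_1: "1 < t \<Longrightarrow> 1 \<le> hoelder_conj t"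
  by (simp add: hoelder_conj_def)

text \<open>Puts \<omega> into a Lebesgue space of exponent at least 1. In the case
  \<open>s * p < N\<close> the critical exponent is at least p, so dividing it by
  \<open>1 - \<alpha>\<close> leaves a number above 1, whose conjugate is at least 1.\<close>

lemma r_exponent_ge_1:
  assumes "0 < N" "0 < s" "1 < p" "0 < \<alpha>" "\<alpha> < 1"
  shows "1 \<le> r_exponent N s p \<alpha>"
proof (cases "s * p < N")
  case True
  have "1 < p" by fact
  also have "p \<le> N * p / (N - s * p)"
    using True assms by (simp add: field_simps)
  also have "\<dots> \<le> N * p / (N - s * p) / (1 - \<alpha>)"
  proof -
    have le: "x \<le> x / (1 - \<alpha>)" if "0 \<le> x" for x :: real
      using that assms by (simp add: field_simps)
    show ?thesis using True assms by (intro le) auto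
  qed
  finally show ?thesis using True by (simp add: r_exponent_def hoelder_conj_ge_1)
qed (use assms in \<open>simp add: r_exponent_def\<close>)

text \<open>For finite exponent t the domination
  \<open>\<bar>y\<bar> \<le> 1 + \<bar>y\<bar> powr t\<close> suffices, as constants are integrable
  for a finite measure.\<close>

lemma in_Lp_imp_integrable:
  assumes f: "in_Lp r M f" and r: "1 \<le> r" and "finite_measure M"
  shows "integrable M f"
proof -
  interpret finite_measure M by fact
  have [measurable]: "f \<in> borel_measurable M" using f by (simp add: in_Lp_def)
  show ?thesis
  proof (cases "r = \<infinity>")
    case True
    then obtain K where "AE x in M. \<bar>f x\<bar> \<le> K" using f by (auto simp: in_Lp_def)
    then show ?thesis by (intro integrable_const_bound[of _ K]) auto
  next
    case False
    with r obtain t where t: "r = ereal t" "1 \<le> t" by (cases r) auto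
    have "integrable M (\<lambda>x. \<bar>f x\<bar> powr t)"
      using f False t by (intro integrableI_nonneg) (auto simp: in_Lp_def)
    then have "integrable M (\<lambda>x. 1 + \<bar>f x\<bar> powr t)" by simp
    then show ?thesis
    proof (rule Bochner_Integration.integrable_bound)
      have "\<bar>y\<bar> \<le> 1 + \<bar>y\<bar> powr t" for y :: real
      proof (cases "\<bar>y\<bar> \<le> 1")
        case False
        then have "\<bar>y\<bar> powr 1 \<le> \<bar>y\<bar> powr t" using t by (intro powr_mono) auto
        then show ?thesis by simp
      qed (simp add: add_increasing2)
      then show "AE x in M. norm (f x) \<le> norm (1 + \<bar>f x\<bar> powr t)" by simp
    qed simp
  qed
qed

theorem corollary3p0p3:
  fixes \<Omega> :: "'a::euclidean_space set"
    and \<omega> u :: "'a \<Rightarrow> real"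
    and s p \<alpha> :: real
    and r :: ereal
  assumes "2 \<le> DIM('a)"
    and "bounded_smooth_domain \<Omega>"
    and "0 < s" "s < 1" "1 < p"
    and "0 < \<alpha>" "\<alpha> < 1"
    and "in_Lp r (restrict_space lborel \<Omega>) \<omega>"
    and "ereal (r_exponent (real DIM('a)) s p \<alpha>) \<le> r"
    and "AE x in restrict_space lborel \<Omega>. 0 \<le> \<omega> x"
    and "\<not> (AE x in restrict_space lborel \<Omega>. \<omega> x = 0)"
    and "weak_solution s p \<Omega> \<alpha> \<omega> u"
  shows "lambda_min s p \<Omega> \<alpha> \<omega> \<in> constrained_energies s p \<Omega> \<alpha> \<omega>
    \<and> lambda_min s p \<Omega> \<alpha> \<omega> = gagliardo s p u powr (p * ((1 - \<alpha> - p) / (1 - \<alpha>)))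
    \<and> (\<forall>C::real.
          (\<forall>v \<in> W0sp s p \<Omega>.
             C * weighted_integral \<Omega> \<alpha> \<omega> v powr (p / (1 - \<alpha>)) \<le> gagliardo s p v powr p)
          \<longleftrightarrow> C \<le> lambda_min s p \<Omega> \<alpha> \<omega>)"
proof -
  have \<Omega>: "open \<Omega>" "bounded \<Omega>" using assms(2) by (auto simp: bounded_smooth_domain_def)
  then have [measurable]: "\<Omega> \<in> sets borel" by simp
  note sol = assms(12)
  have AE_\<Omega>: "(AE x in restrict_space lborel \<Omega>. P x) \<longleftrightarrow> (AE x in lborel. x \<in> \<Omega> \<longrightarrow> P x)" for P
    by (subst AE_restrict_space_iff) auto
  \<comment> \<open>Truncation at 0 changes \<omega> only on a null set of \<Omega> and makes the
    weight nonnegative everywhere, as the locale demands.\<close>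
  define w where "w = (\<lambda>x. max 0 (indicator \<Omega> x * \<omega> x))"
  have \<omega>_borel [measurable]: "(\<lambda>x. indicator \<Omega> x * \<omega> x) \<in> borel_measurable borel"
    using assms(8) by (simp add: in_Lp_def borel_measurable_restrict_space_iff)
  have w_borel [measurable]: "w \<in> borel_measurable borel"
    unfolding w_def by measurable
  have w_eq: "AE x in lborel. indicator \<Omega> x * \<omega> x = w x"
    using assms(10) unfolding AE_\<Omega> by eventually_elim (auto simp: w_def indicator_def)
  have "finite_measure (restrict_space lborel \<Omega>)"
    using emeasure_bounded_finite[OF \<Omega>(2)]
    by (intro finite_measureI) (simp add: emeasure_restrict_space space_restrict_space less_top)
  moreover have "1 \<le> r"
    using order.trans[OF _ assms(9), of 1] r_exponent_ge_1[of "real DIM('a)" s p \<alpha>] assms(3-7) by simp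
  ultimately have "integrable (restrict_space lborel \<Omega>) \<omega>"
    using assms(8) by (intro in_Lp_imp_integrable)
  then have "integrable lborel (\<lambda>x. indicator \<Omega> x * \<omega> x)"
    by (subst (asm) integrable_restrict_space) simp_all
  then have w_int: "integrable lborel w"
  proof (rule Bochner_Integration.integrable_bound)
    show "AE x in lborel. norm (w x) \<le> norm (indicator \<Omega> x * \<omega> x)"
      by (simp add: w_def)
  qed measurable
  interpret singular_solution \<Omega> w u s p \<alpha>
  proof
    show "w \<in> borel_measurable borel" by (rule w_borel)
    show "u \<in> W0sp s p \<Omega>" using sol by (simp add: weak_solution_def)
    then have [measurable]: "u \<in> borel_measurable borel" by (intro Wsp_borel W0sp_Wsp)
    fix \<phi> assume \<phi>: "\<phi> \<in> Cc_inf \<Omega>"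
    note [measurable] = Cc_inf_borel[OF \<phi>]
    have "frac_p_pairing s p u \<phi> = (\<integral>x. (indicator \<Omega> x * \<omega> x) * \<phi> x / u x powr \<alpha> \<partial>lborel)"
      using sol \<phi> by (simp add: weak_solution_def set_lebesgue_integral_def mult.assoc)
    also have "\<dots> = (\<integral>x. w x * \<phi> x / u x powr \<alpha> \<partial>lborel)"
      using w_eq by (intro integral_cong_AE) (auto elim!: eventually_mono)
    finally show "frac_p_pairing s p u \<phi> = (\<integral>x. w x * \<phi> x / u x powr \<alpha> \<partial>lborel)" .
  qed (use assms w_int weak_solution_lower_bound[OF sol \<Omega>(1)] weak_solution_pos[OF sol \<Omega>(1)] in
      \<open>auto simp: w_def\<close>)
  have weighted: "weighted_integral \<Omega> \<alpha> \<omega> v = enn2real (\<integral>\<^sup>+x. ennreal (w x * \<bar>v x\<bar> powr (1 - \<alpha>)) \<partial>lborel)"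
    if "v \<in> W0sp s p \<Omega>" for v
  proof -
    note [measurable] = Wsp_borel[OF W0sp_Wsp[OF that]]
    have "weighted_integral \<Omega> \<alpha> \<omega> v = (\<integral>x. (indicator \<Omega> x * \<omega> x) * \<bar>v x\<bar> powr (1 - \<alpha>) \<partial>lborel)"
      by (simp add: weighted_integral_def set_lebesgue_integral_def mult_ac)
    also have "\<dots> = (\<integral>x. w x * \<bar>v x\<bar> powr (1 - \<alpha>) \<partial>lborel)"
      using w_eq by (intro integral_cong_AE) (auto elim!: eventually_mono)
    also have "\<dots> = enn2real (\<integral>\<^sup>+x. ennreal (w x * \<bar>v x\<bar> powr (1 - \<alpha>)) \<partial>lborel)"
      using w_nonneg by (intro integral_eq_nn_integral) auto
    finally show ?thesis .
  qed
  \<comment> \<open>If the seminorm of u vanished, the energy identity would force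
    \<open>w * u powr (1 - \<alpha>)\<close> to vanish almost everywhere; as u is positive in
    \<Omega>, the weight \<omega> would be zero there.\<close>
  have pos: "0 < gagliardo s p u"
  proof (rule ccontr)
    assume "\<not> 0 < gagliardo s p u"
    then have "gagliardo s p u = 0" using gagliardo_nonneg[of s p u] by linarith
    then have "(\<integral>\<^sup>+x. ennreal (w x * \<bar>u x\<bar> powr (1 - \<alpha>)) \<partial>lborel) = 0"
      by (simp add: energy_identity_nn)
    then have "AE x in lborel. ennreal (w x * \<bar>u x\<bar> powr (1 - \<alpha>)) = 0"
      by (subst (asm) nn_integral_0_iff_AE) auto
    then have "AE x in lborel. x \<in> \<Omega> \<longrightarrow> \<omega> x = 0"
      using w_eq u_pos
    proof eventually_elim
      case (elim x)
      show ?case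
      proof
        assume "x \<in> \<Omega>"
        then have "w x * \<bar>u x\<bar> powr (1 - \<alpha>) \<le> 0" "u x > 0" "\<omega> x = w x"
          using elim by (auto simp: ennreal_eq_0_iff)
        then show "\<omega> x = 0" using w_nonneg[of x] by (auto simp: mult_le_0_iff)
      qed
    qed
    with assms(11) show False unfolding AE_\<Omega> by simp
  qed
  define L where "L = gagliardo s p u powr (p * ((1 - \<alpha> - p) / (1 - \<alpha>)))"
  have bound: "L * weighted_integral \<Omega> \<alpha> \<omega> v powr (p / (1 - \<alpha>)) \<le> gagliardo s p v powr p"
    if "v \<in> W0sp s p \<Omega>" for v
    using weighted_Sobolev[OF that pos] by (simp add: weighted[OF that] L_def)
  obtain v0 where v0: "v0 \<in> W0sp s p \<Omega>" "weighted_integral \<Omega> \<alpha> \<omega> v0 = 1" "gagliardo s p v0 powr p = L"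
    using weighted_Sobolev_extremal[OF pos] weighted unfolding L_def by metis
  have mem: "L \<in> constrained_energies s p \<Omega> \<alpha> \<omega>"
    unfolding constrained_energies_def using v0 by blast
  \<comment> \<open>An admissible v has weighted integral 1, so \<open>bound\<close> reduces to the
    comparison of L with its energy.\<close>
  moreover have "L \<le> E" if "E \<in> constrained_energies s p \<Omega> \<alpha> \<omega>" for E
    using that bound unfolding constrained_energies_def by force
  ultimately have lambda: "lambda_min s p \<Omega> \<alpha> \<omega> = L"
    unfolding lambda_min_def by (rule cInf_eq_minimum)
  have "(\<forall>v \<in> W0sp s p \<Omega>. C * weighted_integral \<Omega> \<alpha> \<omega> v powr (p / (1 - \<alpha>)) \<le> gagliardo s p v powr p)
      \<longleftrightarrow> C \<le> L" for C
  proof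
    assume "\<forall>v \<in> W0sp s p \<Omega>. C * weighted_integral \<Omega> \<alpha> \<omega> v powr (p / (1 - \<alpha>)) \<le> gagliardo s p v powr p"
    \<comment> \<open>The normalized extremal turns the assumed inequality into
      \<open>C * 1 \<le> L\<close>.\<close>
    from bspec[OF this v0(1)] show "C \<le> L" by (simp add: v0)
  next
    assume "C \<le> L"
    \<comment> \<open>C may be negative: only the nonnegativity of the factor multiplying C and L
      enters.\<close>
    then show "\<forall>v \<in> W0sp s p \<Omega>. C * weighted_integral \<Omega> \<alpha> \<omega> v powr (p / (1 - \<alpha>)) \<le> gagliardo s p v powr p"
      using bound by (blast intro: order.trans mult_right_mono powr_ge_zero)
  qed
  then show ?thesis using mem unfolding lambda L_def by simp
qed

end
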